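(* Let $(X,T)$ be a topological dynamical system. For any $\mu\in E(X,T)$ and $\varphi\in C(X,\mathbb{R})$, $$\int\varphi\,\mathrm{d}\mu+h_\mu(T)=\lim_{\varepsilon\to0}\liminf_{n\to\infty}\frac1n\log\hat S_n(\varphi,\mu,\varepsilon)=\lim_{\varepsilon\to0}\limsup_{n\to\infty}\frac1n\log\hat S_n(\varphi,\mu,\varepsilon).$$
   Context: A topological dynamical system is a pair $(X,T)$ where $X$ is a compact metric space with metric $d$ and $T:X\to X$ is a homeomorphism. $C(X,\mathbb{R})$ is the set of continuous real-valued functions on $X$; $E(X,T)$ is the set of ergodic $T$-invariant Borel probability measures on $X$; $h_\mu(T)$ is the (Kolmogorov–Sinai) measure-theoretic entropy. For integers $n,q\ge1$ and $x,y\in X$ put $$\bar d_n^q(x,y)=\frac1n\sum_{i=0}^{n-1}d(T^{qi}x,T^{qi}y),\qquad \hat d_n^q(x,y)=\max\{\bar d_k^q(x,y):1\le k\le n\},$$ $B_{\hat d_n^q}(x,\varepsilon)=\{y\in X:\hat d_n^q(x,y)<\varepsilon\}$, and $S_n^q\varphi(x)=\sum_{i=0}^{n-1}\varphi(T^{qi}x)$. For $\varepsilon>0$, $$S_{\hat d_n^q}(\varphi,\mu,\varepsilon)=\inf\Big\{\sum_{i=1}^k e^{S_n^q\varphi(x_i)}:\ \mu\Big(\bigcup_{i=1}^kB_{\hat d_n^q}(x_i,\varepsilon)\Big)>1-\varepsilon\Big\},$$ the infimum being over finite collections $x_1,\dots,x_k\in X$, and $$\hat S_n(\varphi,\mu,\varepsilon)=\inf_{q\ge1}S_{\hat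 d_n^q}(\varphi,\mu,\varepsilon).$$ *)

theory Defs
  imports "HOL-Probability.Probability" "HOL-Library.Disjoint_Sets"
begin

definition topological_dynamical_system :: "('a::metric_space \<Rightarrow> 'a) \<Rightarrow> bool" where
  "topological_dynamical_system T \<longleftrightarrow>
     compact (UNIV :: 'a set) \<and> (\<exists>T'. homeomorphism UNIV UNIV T T')"

definition ergodic_measures :: "('a::metric_space \<Rightarrow> 'a) \<Rightarrow> 'a measure set" where
  "ergodic_measures T = {\<mu>. prob_space \<mu> \<and> sets \<mu> = sets borel \<and> distr \<mu> \<mu> T = \<mu> \<and>
     (\<forall>A \<in> sets \<mu>. T -` A = A \<longrightarrow> measure \<mu> A = 0 \<or> measure \<mu> A = 1)}"

definition finite_measurable_partition :: "'a measure \<Rightarrow> 'a set set \<Rightarrow> bool" where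
  "finite_measurable_partition \<mu> P \<longleftrightarrow> finite P \<and> P \<subseteq> sets \<mu> \<and> partition_on (space \<mu>) P"

(* Null cells contribute 0, since 0 * ln 0 = 0. *)
definition partition_entropy :: "'a measure \<Rightarrow> 'a set set \<Rightarrow> real" where
  "partition_entropy \<mu> P = - (\<Sum>A\<in>P. measure \<mu> A * ln (measure \<mu> A))"

(* The join of T^(-i) P over 0 <= i < n. *)
definition dynamical_join :: "'a measure \<Rightarrow> ('a \<Rightarrow> 'a) \<Rightarrow> 'a set set \<Rightarrow> nat \<Rightarrow> 'a set set" where
  "dynamical_join \<mu> T P n =
     {space \<mu> \<inter> (\<Inter>i<n. (T ^^ i) -` A i) | A. \<forall>i<n. A i \<in> P} - {{}}"

(* The limit exists for T-invariant \<mu>, by subadditivity. *)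
definition entropy_wrt_partition :: "'a measure \<Rightarrow> ('a \<Rightarrow> 'a) \<Rightarrow> 'a set set \<Rightarrow> real" where
  "entropy_wrt_partition \<mu> T P = lim (\<lambda>n. partition_entropy \<mu> (dynamical_join \<mu> T P n) / real n)"

definition KS_entropy :: "'a measure \<Rightarrow> ('a \<Rightarrow> 'a) \<Rightarrow> ereal" where
  "KS_entropy \<mu> T =
     (SUP P \<in> {P. finite_measurable_partition \<mu> P}. ereal (entropy_wrt_partition \<mu> T P))"

definition mean_dist :: "('a::metric_space \<Rightarrow> 'a) \<Rightarrow> nat \<Rightarrow> nat \<Rightarrow> 'a \<Rightarrow> 'a \<Rightarrow> real" where
  "mean_dist T q n x y = (\<Sum>i<n. dist ((T ^^ (q * i)) x) ((T ^^ (q * i)) y)) / real n"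

definition max_mean_dist :: "('a::metric_space \<Rightarrow> 'a) \<Rightarrow> nat \<Rightarrow> nat \<Rightarrow> 'a \<Rightarrow> 'a \<Rightarrow> real" where
  "max_mean_dist T q n x y = Max ((\<lambda>k. mean_dist T q k x y) ` {1..n})"

definition max_mean_ball :: "('a::metric_space \<Rightarrow> 'a) \<Rightarrow> nat \<Rightarrow> nat \<Rightarrow> 'a \<Rightarrow> real \<Rightarrow> 'a set" where
  "max_mean_ball T q n x \<epsilon> = {y. max_mean_dist T q n x y < \<epsilon>}"

definition orbit_sum :: "('a \<Rightarrow> 'a) \<Rightarrow> nat \<Rightarrow> nat \<Rightarrow> ('a \<Rightarrow> real) \<Rightarrow> 'a \<Rightarrow> real" where
  "orbit_sum T q n \<phi> x = (\<Sum>i<n. \<phi> ((T ^^ (q * i)) x))"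

(* For n, q >= 1 and \<epsilon> > 0 on a compact space, this is the infimum of a nonempty set of
   positive reals, so the real-valued Inf is the usual one. *)
definition S_max_mean ::
  "('a::metric_space \<Rightarrow> 'a) \<Rightarrow> nat \<Rightarrow> nat \<Rightarrow> ('a \<Rightarrow> real) \<Rightarrow> 'a measure \<Rightarrow> real \<Rightarrow> real" where
  "S_max_mean T q n \<phi> \<mu> \<epsilon> =
     Inf {(\<Sum>i=1..k. exp (orbit_sum T q n \<phi> (x i))) | (k :: nat) (x :: nat \<Rightarrow> 'a).
            k \<ge> 1 \<and> measure \<mu> (\<Union>i\<in>{1..k}. max_mean_ball T q n (x i) \<epsilon>) > 1 - \<epsilon>}"

definition S_hat ::
  "('a::metric_space \<Rightarrow> 'a) \<Rightarrow> nat \<Rightarrow> ('a \<Rightarrow> real) \<Rightarrow> 'a measure \<Rightarrow> real \<Rightarrow> real" where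
  "S_hat T n \<phi> \<mu> \<epsilon> = (INF q\<in>{1..}. S_max_mean T q n \<phi> \<mu> \<epsilon>)"

end

(* Lower bound. Fix a finite partition P and let a family of balls of the metric of length n and step q
   cover a set of measure greater than 1 - eps. The centre of a ball predicts the P-letter of T^(q i) y
   at all but a small proportion of the times i < n. Weighting the centres x by exp (S_n phi x) turns this
   prediction into a subprobability on names, and Gibbs' inequality bounds the entropy of the join of
   the T^(-q i) P by ln (sum of exp (S_n phi x)) - n * (integral of phi) + o(n). That entropy is at
   least n * h(T, P) for every q.

   Upper bound. Take q = 1 and a partition whose cells have diameter less than eps, so that points with
   the same name lie in a common ball. The maximal ergodic inequality, applied to phi and to the
   information function of the join of k preimages of P with H_k / k close to h(T, P), shows that most
   points have S_n phi at most n * (integral of phi + small) and a name coded, up to an offset below k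
   and k letters, by consecutive k-blocks whose probabilities multiply to at least
   exp (- n * (h(T, P) + small)). Hence there are few such names. *)
theory Submission
  imports Defs
begin

text \<open>The obstacle is the infimum over q. The lower bound therefore counts nothing: it
  compares entropies, which rests on invariance alone, and invariance makes the integrated errors
  depend on the number of times only, not on q. The upper bound is free to choose q, but the blocks
  of its coding move under T^k, which need not be ergodic either. Averaging the information function
  over all times, and not over multiples of k, keeps the argument with T; the offset is chosen
  afterwards, separately for each point. What the counting uses is one-sided: upper estimates, in
  probability, for ergodic sums. Partitions are handled as labelling functions. Joins then become
  names on finite sets of times, and arithmetic progressions of times cause no extra
  notation.\<close>

section \<open>Subadditive sequences and regularity of Borel measures\<close>

text \<open>Fekete's lemma: the limit is the infimum of the quotients. The infimum starts at n = 1
  because \<open>a 0 / real 0\<close> is 0 by convention and would be the minimum.\<close>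

lemma subadditive_quotient_limit:
  fixes a :: "nat \<Rightarrow> real"
  assumes sub: "\<And>m n. a (m + n) \<le> a m + a n" and nonneg: "\<And>n. 0 \<le> a n"
  obtains L where "(\<lambda>n. a n / real n) \<longlonglongrightarrow> L" "\<And>n. n \<ge> 1 \<Longrightarrow> L \<le> a n / real n"
proof -
  define L where "L = (INF n\<in>{1..}. a n / real n)"
  have bdd: "bdd_below ((\<lambda>n. a n / real n) ` {1..})"
    using nonneg by (intro bdd_belowI[of _ 0]) auto
  have lower: "L \<le> a n / real n" if "n \<ge> 1" for n
    unfolding L_def using bdd that by (intro cINF_lower) auto
  have multiple: "a (k * q) \<le> real q * a k" if "q \<ge> 1" for k q
    using that
  proof (induction q rule: nat_induct_at_least)
    case (Suc q)
    then show ?case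
      using sub[of k "k * q"] by (simp add: algebra_simps)
  qed simp
  have "(\<lambda>n. a n / real n) \<longlonglongrightarrow> L"
  proof (rule LIMSEQ_I)
    fix e :: real assume "e > 0"
    have "\<exists>x\<in>(\<lambda>n. a n / real n) ` {1..}. x < L + e / 2"
      using cInf_lessD[of "(\<lambda>n. a n / real n) ` {1..}" "L + e / 2"] \<open>e > 0\<close>
      by (auto simp: L_def)
    then obtain k where k: "k \<ge> 1" "a k / real k < L + e / 2" by auto
    define C where "C = Max (a ` {..<k})"
    have C: "a j \<le> C" if "j < k" for j
      unfolding C_def using that by (intro Max_ge) auto
    have "C \<ge> 0" using C[of 0] nonneg[of 0] k by simp
    have "(\<lambda>n. C / real n) \<longlonglongrightarrow> 0" by (rule lim_const_over_n)
    then have "\<forall>\<^sub>F n in sequentially. C / real n < e / 2"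
      using \<open>e > 0\<close> by (intro order_tendstoD(2)) auto
    then obtain N where N: "\<And>n. n \<ge> N \<Longrightarrow> C / real n < e / 2"
      by (auto simp: eventually_sequentially)
    show "\<exists>no. \<forall>n\<ge>no. norm (a n / real n - L) < e"
    proof (intro exI allI impI)
      fix n assume n: "n \<ge> max N k"
      then have pos: "n \<ge> 1" "n div k \<ge> 1" using k by (auto simp: Suc_le_eq div_greater_zero_iff)
      have "a n \<le> a (k * (n div k)) + a (n mod k)"
        using sub[of "k * (n div k)" "n mod k"] by simp
      also have "\<dots> \<le> real (n div k) * a k + C"
        using multiple[OF pos(2), of k] C[of "n mod k"] k by simp
      also have "real (n div k) * a k \<le> real n / real k * a k"
        using nonneg[of k] by (intro mult_right_mono of_nat_div_le_of_nat) auto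
      finally have "a n \<le> real n * (a k / real k) + C" by simp
      then have "a n / real n \<le> (real n * (a k / real k) + C) / real n"
        by (intro divide_right_mono) auto
      also have "\<dots> = a k / real k + C / real n"
        using pos by (simp add: add_divide_distrib)
      also have "\<dots> < L + e"
        using N[of n] n k by linarith
      finally show "norm (a n / real n - L) < e"
        using lower[OF pos(1)] by simp
    qed
  qed
  then show thesis using lower that by blast
qed

text \<open>The points at distance at least 1/(n+1) from the complement form closed sets that
  exhaust an open set. The whole space is a separate case since \<open>infdist x {}\<close> is 0 by
  convention, which would make all these sets empty.\<close>

lemma closed_increasing_to_open:
  fixes U :: "'a::metric_space set"
  assumes "open U"
  obtains F :: "nat \<Rightarrow> 'a set" where "incseq F" "\<And>n. closed (F n)" "(\<Union>n. F n) = U"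
proof (cases "U = UNIV")
  case True
  then show thesis by (intro that[of "\<lambda>_. UNIV"]) (auto simp: incseq_def)
next
  case False
  define F where "F = (\<lambda>n::nat. {x. infdist x (- U) \<ge> 1 / real (Suc n)})"
  have cont: "continuous_on UNIV (\<lambda>x. infdist x (- U))"
    by (intro continuous_intros)
  have "incseq F"
    unfolding F_def incseq_def by (auto intro: order_trans[rotated] intro!: frac_le)
  moreover have "closed (F n)" for n
    unfolding F_def using cont by (intro closed_Collect_le) auto
  moreover have "(\<Union>n. F n) = U"
  proof (intro equalityI subsetI)
    fix x assume "x \<in> (\<Union>n. F n)"
    then obtain n where "infdist x (- U) \<ge> 1 / real (Suc n)" by (auto simp: F_def)
    then have "infdist x (- U) > 0"
      by (rule less_le_trans[rotated]) simp
    then show "x \<in> U" using infdist_zero[of x "- U"] by (cases "x \<in> U") auto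
  next
    fix x assume "x \<in> U"
    then have "infdist x (- U) \<noteq> 0"
      using in_closed_iff_infdist_zero[of "- U" x] assms False by auto
    then have "infdist x (- U) > 0" using infdist_nonneg[of x "- U"] by linarith
    then obtain n where "1 / real (Suc n) < infdist x (- U)"
      using nat_approx_posE by blast
    then show "x \<in> (\<Union>n. F n)" by (auto simp: F_def intro!: exI[of _ n])
  qed
  ultimately show thesis by (rule that)
qed

text \<open>Induction over the generated sigma-algebra. Approximating from both sides at once makes
  the claim symmetric: the complement step exchanges the roles of F and U, because - F - - U = U -
  F.\<close>

lemma borel_closed_open_approx:
  fixes M :: "'a::metric_space measure"
  assumes fin: "finite_measure M" and M: "sets M = sets borel" and A: "A \<in> sets M" and "e > 0"
  shows "\<exists>F U. closed F \<and> open U \<and> F \<subseteq> A \<and> A \<subseteq> U \<and> measure M (U - F) < e"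
proof -
  interpret finite_measure M by fact
  have meas [measurable]: "\<And>U. open U \<Longrightarrow> U \<in> sets M" "\<And>F. closed F \<Longrightarrow> F \<in> sets M"
    by (auto simp: M)
  have "A \<in> sigma_sets UNIV {S. open S}" using A M by (simp add: borel_def)
  then show ?thesis using \<open>e > 0\<close>
  proof (induction arbitrary: e)
    case (Basic S)
    then have "open S" by simp
    obtain F :: "nat \<Rightarrow> 'a set" where F: "incseq F" "\<And>n. closed (F n)" "(\<Union>n. F n) = S"
      using closed_increasing_to_open[OF \<open>open S\<close>] by blast
    have "(\<lambda>n. measure M (F n)) \<longlonglongrightarrow> measure M S"
      using finite_Lim_measure_incseq[OF _ F(1)] F(2) meas(2) unfolding F(3) by blast
    then have "\<forall>\<^sub>F n in sequentially. measure M (F n) > measure M S - e"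
      using Basic by (intro order_tendstoD(1)) auto
    then obtain n where "measure M (F n) > measure M S - e"
      by (auto simp: eventually_sequentially)
    moreover have "measure M (S - F n) = measure M S - measure M (F n)"
      using F \<open>open S\<close> by (intro finite_measure_Diff) (auto simp: meas)
    ultimately show ?case
      using F \<open>open S\<close> by (intro exI[of _ "F n"] exI[of _ S]) auto
  next
    case Empty
    then show ?case by (intro exI[of _ "{}"]) auto
  next
    case (Compl S)
    then obtain F U where "closed F" "open U" "F \<subseteq> S" "S \<subseteq> U" "measure M (U - F) < e"
      by metis
    moreover have "- F - - U = U - F" by auto
    ultimately show ?case
      by (intro exI[of _ "- U"] exI[of _ "- F"]) auto
  next
    case (Union S)
    \<comment> \<open>The budgets add up to e / 2; the slack up to e pays for the truncation
      below.\<close>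
    have "\<exists>F U. closed F \<and> open U \<and> F \<subseteq> S i \<and> S i \<subseteq> U \<and> measure M (U - F) < e / 2 * (1 / 2) ^ Suc i" for i
      using Union.prems by (intro Union.IH) auto
    then obtain F U where FU: "\<And>i. closed (F i)" "\<And>i. open (U i)" "\<And>i. F i \<subseteq> S i"
        "\<And>i. S i \<subseteq> U i" "\<And>i. measure M (U i - F i) < e / 2 * (1 / 2) ^ Suc i"
      by metis
    let ?U = "\<Union>i. U i" and ?F = "\<lambda>n. \<Union>i<n. F i"
    have sums: "(\<lambda>i. e / 2 * (1 / 2) ^ Suc i) sums (e / 2 * 1)"
      by (intro sums_mult power_half_series)
    have [measurable]: "U i - F i \<in> sets M" for i by (intro sets.Diff meas FU)
    have summ: "summable (\<lambda>i. measure M (U i - F i))"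
      by (rule summable_comparison_test'[OF sums_summable[OF sums], where N=0])
        (simp only: real_norm_def abs_of_nonneg measure_nonneg less_imp_le[OF FU(5)])
    have "measure M (?U - (\<Union>i. F i)) \<le> measure M (\<Union>i. U i - F i)"
      by (intro finite_measure_mono) (auto)
    also have "\<dots> \<le> (\<Sum>i. measure M (U i - F i))"
      using summ by (intro finite_measure_subadditive_countably) auto
    also have "\<dots> \<le> (\<Sum>i. e / 2 * (1 / 2) ^ Suc i)"
      by (intro suminf_le less_imp_le[OF FU(5)] summ sums_summable[OF sums])
    also have "\<dots> < e" using sums_unique[OF sums] Union.prems by simp
    finally have less: "measure M (?U - (\<Union>i. F i)) < e" .
    have closed: "closed (?F n)" for n using FU(1) by auto
    \<comment> \<open>An infinite union of closed sets need not be closed, so it is cut off at a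
      finite stage; continuity from above keeps the error below e.\<close>
    have "(\<lambda>n. measure M (?U - ?F n)) \<longlonglongrightarrow> measure M (\<Inter>n. ?U - ?F n)"
    proof (rule finite_Lim_measure_decseq)
      show "range (\<lambda>n. ?U - ?F n) \<subseteq> sets M" using closed FU(2) by (auto simp: meas)
      show "decseq (\<lambda>n. ?U - ?F n)" by (auto simp: decseq_def)
    qed
    moreover have "(\<Inter>n. ?U - ?F n) = ?U - (\<Union>i. F i)" by blast
    ultimately have "\<forall>\<^sub>F n in sequentially. measure M (?U - ?F n) < e"
      using less by (intro order_tendstoD(2)) auto
    then obtain n where "measure M (?U - ?F n) < e" by (auto simp: eventually_sequentially)
    moreover have "?F n \<subseteq> (\<Union>i. S i)"
      using FU(3) by (intro UN_mono) auto
    moreover have "(\<Union>i. S i) \<subseteq> ?U"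
      using FU(4) by (intro UN_mono) auto
    moreover have "open ?U" using FU(2) by (intro open_UN) auto
    ultimately show ?case
      using closed[of n] by (intro exI[of _ "?F n"] exI[of _ ?U] conjI)
  qed
qed

lemma separate_disjoint_compacts:
  fixes S T :: "'a::metric_space set"
  assumes "compact S" "closed T" "S \<inter> T = {}"
  shows "\<exists>\<delta>>0. \<forall>x\<in>S. \<forall>y\<in>T. \<delta> \<le> dist x y"
proof (cases "S = {} \<or> T = {}")
  case False
  have "continuous_on S (\<lambda>x. infdist x T)" by (intro continuous_intros)
  then obtain x where x: "x \<in> S" "\<forall>y\<in>S. infdist x T \<le> infdist y T"
    using continuous_attains_inf[OF \<open>compact S\<close>] False by auto
  have "infdist x T \<noteq> 0"
    using in_closed_iff_infdist_zero[OF \<open>closed T\<close>, of x] x assms False by auto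
  then have "infdist x T > 0" using infdist_nonneg[of x T] by linarith
  then show ?thesis
    using x by (intro exI[of _ "infdist x T"]) (auto intro: order_trans infdist_le)
qed (auto intro: zero_less_one)

section \<open>Ergodic sums\<close>

text \<open>The base \<open>exp 1\<close> turns the logarithm of \<open>information_space\<close>
  into \<open>ln\<close>, so that its entropy agrees with \<open>partition_entropy\<close> and its
  entropy inequalities become available.\<close>

locale invariant_system = information_space M "exp 1" for M :: "'a measure" +
  fixes T :: "'a \<Rightarrow> 'a"
  assumes space_eq [simp]: "space M = UNIV"
    and T_measurable [measurable]: "T \<in> M \<rightarrow>\<^sub>M M"
    and T_invariant: "distr M M T = M"
begin

lemma prob_UNIV [simp]: "prob UNIV = 1"
  using prob_space by simp

lemma T_pow_measurable [measurable]: "(T ^^ n) \<in> M \<rightarrow>\<^sub>M M"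
  by (rule measurable_compose_n[OF T_measurable])

lemma T_pow_invariant: "distr M M (T ^^ n) = M"
proof (induction n)
  case 0
  have "distr M M (T ^^ 0) = distr M M (\<lambda>x. x)" by (simp add: id_def)
  then show ?case by (simp only: distr_id)
next
  case (Suc n)
  have "distr M M (T ^^ Suc n) = distr (distr M M (T ^^ n)) M T"
    by (subst distr_distr) (auto simp: o_def)
  then show ?case by (simp only: Suc T_invariant)
qed

lemma prob_T_pow_vimage:
  assumes "A \<in> sets M"
  shows "prob ((T ^^ n) -` A) = prob A"
  using measure_distr[of "T ^^ n" M M A] assms by (simp add: T_pow_invariant)

lemma AE_T_pow:
  assumes "AE x in M. Q x" "{x. Q x} \<in> sets M"
  shows "AE x in M. Q ((T ^^ n) x)"
proof -
  have "AE x in distr M M (T ^^ n). Q x" using assms(1) by (subst T_pow_invariant)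
  then show ?thesis using assms by (subst (asm) AE_distr_iff) auto
qed

lemma integral_T_pow:
  fixes g :: "'a \<Rightarrow> real"
  assumes "g \<in> borel_measurable M"
  shows "(\<integral>x. g ((T ^^ n) x) \<partial>M) = (\<integral>x. g x \<partial>M)"
  using integral_distr[of "T ^^ n" M M g] assms by (simp add: T_pow_invariant)

lemma integrable_T_pow:
  fixes g :: "'a \<Rightarrow> real"
  assumes "integrable M g"
  shows "integrable M (\<lambda>x. g ((T ^^ n) x))"
  using integrable_distr[of "T ^^ n" M M g] assms by (simp add: T_pow_invariant)

lemma orbit_sum_measurable [measurable]:
  assumes "g \<in> borel_measurable M" shows "orbit_sum T q n g \<in> borel_measurable M"
  unfolding orbit_sum_def[abs_def]
  by (rule borel_measurable_sum) (rule measurable_compose[OF T_pow_measurable assms])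

lemma integrable_orbit_sum: "integrable M g \<Longrightarrow> integrable M (orbit_sum T q n g)"
  unfolding orbit_sum_def[abs_def] by (intro Bochner_Integration.integrable_sum integrable_T_pow)

lemma orbit_sum_Suc: "orbit_sum T 1 (Suc n) g x = g x + orbit_sum T 1 n g (T x)"
  unfolding orbit_sum_def by (subst sum.lessThan_Suc_shift) (simp add: funpow_swap1)

(* Garsia's proof: on the set where the maximal function m is positive, m x \<le> g x + m (T x). *)
lemma maximal_inequality:
  fixes g :: "'a \<Rightarrow> real"
  assumes g: "integrable M g"
  shows "0 \<le> (\<integral>x. indicator {x. \<exists>n\<le>N. orbit_sum T 1 n g x > 0} x * g x \<partial>M)"
proof -
  \<comment> \<open>The index 0, with empty sum 0, makes m nonnegative; the index at which a
    positive value of m is attained is therefore a successor.\<close>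
  define m where "m = (\<lambda>x. Max ((\<lambda>n. orbit_sum T 1 n g x) ` {..N}))"
  have [measurable]: "g \<in> borel_measurable M" using g by auto
  have m_ge: "orbit_sum T 1 n g x \<le> m x" if "n \<le> N" for n x
    unfolding m_def using that by (intro Max_ge) auto
  have m_nonneg: "0 \<le> m x" for x
    using m_ge[of 0 x] by (simp add: orbit_sum_def)
  have m_attained: "\<exists>n\<le>N. m x = orbit_sum T 1 n g x" for x
  proof -
    have "m x \<in> (\<lambda>n. orbit_sum T 1 n g x) ` {..N}"
      unfolding m_def by (intro Max_in) auto
    then show ?thesis by auto
  qed
  have m_meas [measurable]: "m \<in> borel_measurable M"
    unfolding m_def by (intro borel_measurable_Max orbit_sum_measurable) auto
  have m_int: "integrable M m"
  proof (rule Bochner_Integration.integrable_bound)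
    show "integrable M (\<lambda>x. \<Sum>n\<le>N. \<bar>orbit_sum T 1 n g x\<bar>)"
      using integrable_orbit_sum[OF g] by (intro Bochner_Integration.integrable_sum integrable_abs)
    show "AE x in M. norm (m x) \<le> norm (\<Sum>n\<le>N. \<bar>orbit_sum T 1 n g x\<bar>)"
    proof (rule AE_I2)
      fix x
      obtain n where n: "n \<le> N" "m x = orbit_sum T 1 n g x" using m_attained[of x] by (elim exE conjE)
      have "\<bar>orbit_sum T 1 n g x\<bar> \<le> (\<Sum>n\<le>N. \<bar>orbit_sum T 1 n g x\<bar>)"
        using n by (intro member_le_sum) auto
      then show "norm (m x) \<le> norm (\<Sum>n\<le>N. \<bar>orbit_sum T 1 n g x\<bar>)" using n by simp
    qed
  qed simp
  have "m x - m (T x) \<le> indicator {x. \<exists>n\<le>N. orbit_sum T 1 n g x > 0} x * g x" for x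
  proof (cases "\<exists>n\<le>N. orbit_sum T 1 n g x > 0")
    case True
    obtain n where n: "n \<le> N" "m x = orbit_sum T 1 n g x" using m_attained[of x] by (elim exE conjE)
    have "m x > 0" using True m_ge by (meson less_le_trans)
    then obtain n' where "n = Suc n'" using n by (cases n) (auto simp: orbit_sum_def)
    then have "m x \<le> g x + m (T x)"
      using m_ge[of n' "T x"] n orbit_sum_Suc[of n' g x] by simp
    then show ?thesis using True by simp
  next
    case False
    then have "m x \<le> 0" using m_attained[of x] by (metis not_less)
    then show ?thesis using False m_nonneg[of "T x"] by simp
  qed
  moreover have "integrable M (\<lambda>x. m (T x))" "(\<integral>x. m (T x) \<partial>M) = (\<integral>x. m x \<partial>M)"
    using integrable_T_pow[OF m_int, of 1] integral_T_pow[OF m_meas, of 1] by auto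
  moreover have "integrable M (\<lambda>x. indicator {x. \<exists>n\<le>N. orbit_sum T 1 n g x > 0} x * g x)"
  proof (subst mult.commute, rule integrable_real_mult_indicator)
    have "{x \<in> space M. \<exists>n\<in>{..N}. orbit_sum T 1 n g x > 0} \<in> sets M" by measurable
    then show "{x. \<exists>n\<le>N. orbit_sum T 1 n g x > 0} \<in> sets M" by (simp add: Bex_def)
  qed (rule g)
  ultimately have "(\<integral>x. m x - m (T x) \<partial>M) \<le>
      (\<integral>x. indicator {x. \<exists>n\<le>N. orbit_sum T 1 n g x > 0} x * g x \<partial>M)"
    using m_int by (intro integral_mono) auto
  then show ?thesis
    using m_int \<open>integrable M (\<lambda>x. m (T x))\<close> \<open>(\<integral>x. m (T x) \<partial>M) = (\<integral>x. m x \<partial>M)\<close> by simp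
qed

text \<open>The sets in the maximal inequality increase to a set of full measure, so dominated
  convergence removes the indicator.\<close>

lemma integral_nonneg_if_orbit_sum_pos:
  fixes g :: "'a \<Rightarrow> real"
  assumes g: "integrable M g" and pos: "AE x in M. \<exists>n. orbit_sum T 1 n g x > 0"
  shows "0 \<le> (\<integral>x. g x \<partial>M)"
proof -
  have [measurable]: "g \<in> borel_measurable M" using g by auto
  let ?E = "\<lambda>N. {x. \<exists>n\<le>N. orbit_sum T 1 n g x > 0}"
  have [measurable]: "?E N \<in> sets M" for N
  proof -
    have "{x \<in> space M. \<exists>n\<in>{..N}. orbit_sum T 1 n g x > 0} \<in> sets M" by measurable
    then show ?thesis by (simp add: Bex_def)
  qed
  have "(\<lambda>N. \<integral>x. indicator (?E N) x * g x \<partial>M) \<longlonglongrightarrow> (\<integral>x. g x \<partial>M)"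
  proof (rule integral_dominated_convergence)
    show "integrable M (\<lambda>x. \<bar>g x\<bar>)" using g by auto
    show "AE x in M. (\<lambda>N. indicator (?E N) x * g x) \<longlonglongrightarrow> g x"
      using pos
    proof eventually_elim
      case (elim x)
      then obtain n where "orbit_sum T 1 n g x > 0" by blast
      then have "indicator (?E N) x * g x = g x" if "N \<ge> n" for N
        using that by (auto simp: indicator_def)
      then have "\<forall>\<^sub>F N in sequentially. indicator (?E N) x * g x = g x"
        by (auto simp: eventually_sequentially)
      then show ?case by (rule tendsto_eventually)
    qed
    show "AE x in M. norm (indicator (?E N) x * g x) \<le> \<bar>g x\<bar>" for N
      by (auto simp: indicator_def)
  qed auto
  then show ?thesis
    using maximal_inequality[OF g] by (intro LIMSEQ_le_const) auto
qed

text \<open>If the sums of g - d were unbounded above on a set of positive measure, that set, being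
  invariant, would have full measure, and the maximal inequality would make the integral of g - d
  nonnegative. So they are almost surely bounded above, and the sums of g exceed n c for finitely
  many n only.\<close>

lemma ergodic_orbit_sum_upper:
  fixes g :: "'a \<Rightarrow> real"
  assumes ergodic: "\<And>A. A \<in> sets M \<Longrightarrow> T -` A = A \<Longrightarrow> prob A = 0 \<or> prob A = 1"
    and g: "integrable M g" and c: "(\<integral>x. g x \<partial>M) < c"
  shows "(\<lambda>n. prob {x. orbit_sum T 1 n g x > real n * c}) \<longlonglongrightarrow> 0"
proof -
  have [measurable]: "g \<in> borel_measurable M" using g by auto
  \<comment> \<open>The midpoint leaves room on both sides: g - d still has negative integral, and a
    sum of g above n c is a sum of g - d above n (c - d).\<close>
  define d where "d = ((\<integral>x. g x \<partial>M) + c) / 2"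
  have d: "(\<integral>x. g x \<partial>M) < d" "d < c" using c by (auto simp: d_def)
  define f where "f = (\<lambda>x. g x - d)"
  have f: "integrable M f" "(\<integral>x. f x \<partial>M) < 0"
    using g d by (auto simp: f_def)
  then have [measurable]: "f \<in> borel_measurable M" by auto
  have f_sum: "orbit_sum T 1 n f x = orbit_sum T 1 n g x - real n * d" for n x
    by (simp add: orbit_sum_def f_def sum_subtractf)
  \<comment> \<open>Unboundedness is unaffected by one more summand, so E equals its preimage
    exactly, as the ergodicity hypothesis requires.\<close>
  define E where "E = {x. \<forall>K::nat. \<exists>n. orbit_sum T 1 n f x > real K}"
  have "{x \<in> space M. \<forall>K::nat. \<exists>n. orbit_sum T 1 n f x > real K} \<in> sets M" by measurable
  then have E_sets: "E \<in> sets M" by (simp add: E_def)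
  have shift: "(\<forall>K::nat. \<exists>n. orbit_sum T 1 n f (T x) > real K) \<longleftrightarrow>
      (\<forall>K::nat. \<exists>n. orbit_sum T 1 n f x > real K)" (is "?l \<longleftrightarrow> ?r") for x
  proof
    assume ?l
    show ?r
    proof
      fix K :: nat
      obtain K' :: nat where "real K' \<ge> real K - f x" using real_arch_simple by blast
      moreover obtain n where "orbit_sum T 1 n f (T x) > real K'" using \<open>?l\<close> by blast
      ultimately have "orbit_sum T 1 (Suc n) f x > real K" using orbit_sum_Suc[of n f x] by linarith
      then show "\<exists>n. orbit_sum T 1 n f x > real K" by blast
    qed
  next
    assume ?r
    show ?l
    proof
      fix K :: nat
      obtain K' :: nat where K': "real K' \<ge> real K + f x" using real_arch_simple by blast
      moreover obtain n where n: "orbit_sum T 1 n f x > real K'" using \<open>?r\<close> by blast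
      moreover obtain m where "n = Suc m"
        using n by (cases n) (auto simp: orbit_sum_def)
      ultimately have "orbit_sum T 1 m f (T x) > real K" using orbit_sum_Suc[of m f x] by simp
      then show "\<exists>n. orbit_sum T 1 n f (T x) > real K" by blast
    qed
  qed
  have "T -` E = E"
    by (simp only: E_def vimage_def mem_Collect_eq shift)
  then have "prob E = 0 \<or> prob E = 1" by (rule ergodic[OF E_sets])
  moreover have "prob E \<noteq> 1"
  proof
    assume "prob E = 1"
    then have "AE x in M. x \<in> E" using E_sets by (subst AE_in_set_eq_1)
    then have "AE x in M. \<exists>n. orbit_sum T 1 n f x > 0"
    proof eventually_elim
      case (elim x)
      then have "\<exists>n. orbit_sum T 1 n f x > real 0"
        unfolding E_def mem_Collect_eq by (rule spec)
      then show ?case by simp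
    qed
    then show False using integral_nonneg_if_orbit_sum_pos[OF f(1)] f(2) by simp
  qed
  ultimately have E_null: "prob E = 0" by simp
  \<comment> \<open>Passing from an excess at time n to an excess at some time from m on gives a
    decreasing family whose intersection lies in the null set E.\<close>
  let ?B = "\<lambda>m. {x. \<exists>n\<ge>m. orbit_sum T 1 n g x > real n * c}"
  have B_sets: "?B m \<in> sets M" for m
  proof -
    have "{x \<in> space M. \<exists>n\<in>{m..}. orbit_sum T 1 n g x > real n * c} \<in> sets M" by measurable
    then show ?thesis by (simp add: Bex_def)
  qed
  have "(\<Inter>m. ?B m) \<subseteq> E"
  proof
    fix x assume x: "x \<in> (\<Inter>m. ?B m)"
    have "\<exists>n. orbit_sum T 1 n f x > real K" for K :: nat
    proof -
      obtain m :: nat where m: "real m * (c - d) > real K"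
        using reals_Archimedean3[of "c - d"] d by auto
      obtain n where n: "n \<ge> m" "orbit_sum T 1 n g x > real n * c" using x by auto
      have "real m * (c - d) \<le> real n * (c - d)"
        using n d by (intro mult_right_mono) auto
      then have "orbit_sum T 1 n f x > real K"
        using m n f_sum[of n x] by (simp add: algebra_simps)
      then show ?thesis by blast
    qed
    then show "x \<in> E" by (simp add: E_def)
  qed
  then have "prob (\<Inter>m. ?B m) = 0"
    using finite_measure_mono[of "\<Inter>m. ?B m" E] E_sets E_null measure_nonneg[of M "\<Inter>m. ?B m"]
    by (simp only: order_antisym)
  moreover have "(\<lambda>m. prob (?B m)) \<longlonglongrightarrow> prob (\<Inter>m. ?B m)"
  proof (rule finite_Lim_measure_decseq)
    show "decseq ?B"
    proof (intro decseq_SucI Collect_mono impI)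
      fix m x assume "\<exists>n\<ge>Suc m. orbit_sum T 1 n g x > real n * c"
      then show "\<exists>n\<ge>m. orbit_sum T 1 n g x > real n * c" by (auto intro: Suc_leD)
    qed
    show "range ?B \<subseteq> sets M" using B_sets by (simp only: image_subsetI)
  qed
  ultimately have lim: "(\<lambda>m. prob (?B m)) \<longlonglongrightarrow> 0" by simp
  have "prob {x. orbit_sum T 1 n g x > real n * c} \<le> prob (?B n)" for n
    using B_sets by (intro finite_measure_mono) auto
  then show ?thesis
    by (intro tendsto_sandwich[OF _ _ tendsto_const lim]) auto
qed

subsection \<open>Entropy of simple functions\<close>

abbreviation entropy_of :: "('a \<Rightarrow> 'b) \<Rightarrow> real" (\<open>\<H>'(_')\<close>) where
  "\<H>(X) \<equiv> entropy (exp 1) (count_space (range X)) X"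

lemma simple_vimage_sets:
  assumes "simple_function M X" shows "X -` B \<in> sets M"
  using simple_functionD(2)[OF assms, of B] by simp

lemma simple_range_finite:
  assumes "simple_function M X" shows "finite (range X)"
  using simple_functionD(1)[OF assms] by simp

lemma integral_simple_compose:
  fixes f :: "'b \<Rightarrow> real"
  assumes X: "simple_function M X"
  shows "integrable M (\<lambda>x. f (X x))"
    and "(\<integral>x. f (X x) \<partial>M) = (\<Sum>b\<in>range X. prob (X -` {b}) * f b)"
proof -
  have eq: "f (X x) = (\<Sum>b\<in>range X. indicator (X -` {b}) x * f b)" for x
  proof -
    have "(\<Sum>b\<in>range X. indicator (X -` {b}) x * f b) = (\<Sum>b\<in>range X. if b = X x then f b else 0)"
      by (intro sum.cong) (auto simp: indicator_def)
    then show ?thesis using simple_range_finite[OF X] by simp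
  qed
  have int: "integrable M (\<lambda>x. indicator (X -` {b}) x * f b)" for b
    using simple_vimage_sets[OF X] by (intro integrable_mult_left) (auto simp: emeasure_eq_measure)
  show "integrable M (\<lambda>x. f (X x))"
    unfolding eq using int by (intro Bochner_Integration.integrable_sum)
  show "(\<integral>x. f (X x) \<partial>M) = (\<Sum>b\<in>range X. prob (X -` {b}) * f b)"
    unfolding eq using int simple_vimage_sets[OF X]
    by (subst Bochner_Integration.integral_sum) (auto simp: emeasure_eq_measure)
qed

lemma entropy_simple_eq_sum:
  assumes X: "simple_function M X"
  shows "\<H>(X) = - (\<Sum>b\<in>range X. prob (X -` {b}) * ln (prob (X -` {b})))"
  using entropy_simple_distributed[OF simple_distributedI[OF X measure_nonneg refl]]
  by (simp add: log_def)

text \<open>The integrand is the information function. Unlike the sum over the range, this form can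
  be composed with T and inserted into ergodic sums.\<close>

lemma entropy_simple_eq_integral:
  assumes X: "simple_function M X"
  shows "\<H>(X) = (\<integral>x. - ln (prob (X -` {X x})) \<partial>M)"
  using entropy_simple_eq_sum[OF X] integral_simple_compose(2)[OF X, of "\<lambda>b. - ln (prob (X -` {b}))"]
  by (simp add: sum_negf)

lemma entropy_simple_nonneg:
  assumes X: "simple_function M X"
  shows "0 \<le> \<H>(X)"
  unfolding entropy_simple_eq_integral[OF X]
proof (rule integral_nonneg_AE, rule AE_I2)
  fix x
  show "0 \<le> - ln (prob (X -` {X x}))"
  proof (cases "prob (X -` {X x}) = 0")
    case False
    then have "prob (X -` {X x}) > 0" by (simp add: less_le)
    then show ?thesis using prob_le_1[of "X -` {X x}"] by simp
  qed simp
qed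

text \<open>Gibbs' inequality, from \<open>ln t \<le> t - 1\<close> at t = w b / p b. The
  differences w b - p b sum to at most 0, so subprobability weights suffice, which spares the codes
  below an exact normalisation.\<close>

lemma entropy_le_cross_entropy:
  assumes X: "simple_function M X"
    and pos: "\<And>b. b \<in> range X \<Longrightarrow> 0 < w b" and total: "(\<Sum>b\<in>range X. w b) \<le> 1"
  shows "\<H>(X) \<le> (\<integral>x. - ln (w (X x)) \<partial>M)"
proof -
  define p where "p = (\<lambda>b. prob (X -` {b}))"
  have p_total: "(\<Sum>b\<in>range X. p b) = 1"
    using integral_simple_compose(2)[OF X, of "\<lambda>_. 1"] by (simp add: p_def)
  have "- (p b * ln (p b)) \<le> p b * (- ln (w b)) + (w b - p b)" if b: "b \<in> range X" for b
  proof (cases "p b = 0")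
    case True
    then show ?thesis using pos[OF b] by simp
  next
    case False
    then have "p b > 0" using measure_nonneg[of M "X -` {b}"] by (simp add: p_def less_le)
    then have "p b * ln (w b / p b) \<le> p b * (w b / p b - 1)"
      using pos[OF b] by (intro mult_left_mono ln_le_minus_one) auto
    then show ?thesis
      using \<open>p b > 0\<close> pos[OF b] by (simp add: ln_div algebra_simps)
  qed
  then have "(\<Sum>b\<in>range X. - (p b * ln (p b))) \<le> (\<Sum>b\<in>range X. p b * (- ln (w b)) + (w b - p b))"
    by (intro sum_mono)
  also have "\<dots> \<le> (\<Sum>b\<in>range X. p b * (- ln (w b)))"
    using total p_total by (simp add: sum.distrib sum_subtractf sum_negf)
  also have "\<dots> = (\<integral>x. - ln (w (X x)) \<partial>M)"
    unfolding p_def by (rule integral_simple_compose(2)[OF X, symmetric])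
  finally show ?thesis
    by (simp add: entropy_simple_eq_sum[OF X] p_def sum_negf)
qed

lemma entropy_mono_determined:
  assumes X: "simple_function M X" and det: "\<And>x y. X x = X y \<Longrightarrow> Y x = Y y"
  shows "\<H>(Y) \<le> \<H>(X)"
proof -
  define f where "f = (\<lambda>b. Y (SOME x. X x = b))"
  have "f (X x) = Y x" for x
    unfolding f_def by (rule det) (rule someI, rule refl)
  then have "f \<circ> X = Y" by (simp add: fun_eq_iff)
  then show ?thesis
    using entropy_data_processing[OF X, of f] by (simp only: space_eq)
qed

lemma entropy_Pair_le:
  assumes "simple_function M X" "simple_function M Y"
  shows "\<H>(\<lambda>x. (X x, Y x)) \<le> \<H>(X) + \<H>(Y)"
  using entropy_chain_rule[OF assms] conditional_entropy_less_eq_entropy[OF assms(2,1)] by simp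

lemma simple_function_T_pow:
  assumes "simple_function M X"
  shows "simple_function M (\<lambda>x. X ((T ^^ j) x))"
proof -
  have "(\<lambda>x. X ((T ^^ j) x)) -` {b} \<in> sets M" for b
    using measurable_sets[OF T_pow_measurable simple_vimage_sets[OF assms, of "{b}"], of j]
    by (simp add: vimage_def)
  moreover have "finite (range (\<lambda>x. X ((T ^^ j) x)))"
    by (rule finite_subset[OF _ simple_range_finite[OF assms]]) auto
  ultimately show ?thesis by (auto simp: simple_function_def)
qed

text \<open>The information functions correspond under composition with T^j. Comparing integrals
  avoids comparing sums over two ranges, which may differ when T^j is not onto.\<close>

lemma entropy_T_pow:
  assumes X: "simple_function M X"
  shows "\<H>(\<lambda>x. X ((T ^^ j) x)) = \<H>(X)"
proof -
  have "\<H>(\<lambda>x. X ((T ^^ j) x)) =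
      (\<integral>x. - ln (prob ((\<lambda>x. X ((T ^^ j) x)) -` {X ((T ^^ j) x)})) \<partial>M)"
    by (rule entropy_simple_eq_integral[OF simple_function_T_pow[OF X]])
  also have "\<dots> = (\<integral>x. - ln (prob (X -` {X ((T ^^ j) x)})) \<partial>M)"
  proof -
    have "prob ((\<lambda>x. X ((T ^^ j) x)) -` {b}) = prob (X -` {b})" for b
      using prob_T_pow_vimage[OF simple_vimage_sets[OF X, of "{b}"], of j] by (simp add: vimage_def)
    then show ?thesis by presburger
  qed
  also have "\<dots> = (\<integral>x. - ln (prob (X -` {X x})) \<partial>M)"
    using integral_simple_compose(1)[OF X]
    by (intro integral_T_pow[where g="\<lambda>x. - ln (prob (X -` {X x}))"] borel_measurable_integrable)
  finally show ?thesis by (simp add: entropy_simple_eq_integral[OF X])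
qed

end

section \<open>Names and the entropy rate\<close>

locale labelled_system = invariant_system +
  fixes l :: "'a \<Rightarrow> 'b"
  assumes l_simple: "simple_function M l"
begin

text \<open>The set of times is arbitrary because the steps q lead to arithmetic progressions. The
  restriction makes names extensional, so that they lie in the finite set
  \<open>I \<rightarrow>\<^sub>E range l\<close>.\<close>

definition name :: "nat set \<Rightarrow> 'a \<Rightarrow> nat \<Rightarrow> 'b" where
  "name I x = (\<lambda>i\<in>I. l ((T ^^ i) x))"

lemma name_eq_iff: "name I x = name I y \<longleftrightarrow> (\<forall>i\<in>I. l ((T ^^ i) x) = l ((T ^^ i) y))"
  by (auto simp: name_def restrict_def fun_eq_iff)

lemma name_in_PiE: "name I x \<in> I \<rightarrow>\<^sub>E range l"
  by (simp add: name_def)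

lemma finite_names: "finite I \<Longrightarrow> finite (I \<rightarrow>\<^sub>E range l)"
  using simple_range_finite[OF l_simple] by (intro finite_PiE) auto

lemma name_simple:
  assumes "finite I" shows "simple_function M (name I)"
proof -
  have "name I -` {name I x} \<in> sets M" for x
  proof -
    have "{y \<in> space M. l ((T ^^ i) y) = c} \<in> sets M" for i c
      using simple_vimage_sets[OF simple_function_T_pow[OF l_simple], of i "{c}"]
      by (simp add: vimage_def)
    then have "{y \<in> space M. \<forall>i\<in>I. l ((T ^^ i) y) = l ((T ^^ i) x)} \<in> sets M"
      using assms by (intro sets.sets_Collect_finite_All)
    also have "{y \<in> space M. \<forall>i\<in>I. l ((T ^^ i) y) = l ((T ^^ i) x)} = name I -` {name I x}"
      by (auto simp: name_eq_iff)
    finally show ?thesis .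
  qed
  moreover have "finite (range (name I))"
    using name_in_PiE by (intro finite_subset[OF _ finite_names[OF assms]]) auto
  ultimately show ?thesis by (auto simp: simple_function_def)
qed

lemma entropy_name_Un:
  assumes "finite I" "finite J"
  shows "\<H>(name (I \<union> J)) \<le> \<H>(name I) + \<H>(name J)"
proof -
  have "\<H>(name (I \<union> J)) \<le> \<H>(\<lambda>x. (name I x, name J x))"
    using assms by (intro entropy_mono_determined simple_function_Pair name_simple) (auto simp: name_eq_iff)
  also have "\<dots> \<le> \<H>(name I) + \<H>(name J)"
    using assms by (intro entropy_Pair_le name_simple)
  finally show ?thesis .
qed

lemma entropy_name_shift:
  assumes "finite I"
  shows "\<H>(name ((+) j ` I)) \<le> \<H>(name I)"
proof -
  have "\<H>(name ((+) j ` I)) \<le> \<H>(\<lambda>x. name I ((T ^^ j) x))"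
    using assms
    by (intro entropy_mono_determined simple_function_T_pow name_simple)
      (auto simp: name_eq_iff add.commute[of j] funpow_add)
  also have "\<dots> = \<H>(name I)" by (rule entropy_T_pow[OF name_simple[OF assms]])
  finally show ?thesis .
qed

definition entropy_rate :: real where
  "entropy_rate = lim (\<lambda>n. \<H>(name {..<n}) / real n)"

lemma entropy_rate:
  shows entropy_rate_lim: "(\<lambda>n. \<H>(name {..<n}) / real n) \<longlonglongrightarrow> entropy_rate"
    and entropy_rate_le: "n \<ge> 1 \<Longrightarrow> entropy_rate \<le> \<H>(name {..<n}) / real n"
proof -
  have "\<H>(name {..<m + n}) \<le> \<H>(name {..<m}) + \<H>(name {..<n})" for m n
  proof -
    have "{..<m + n} = {..<m} \<union> (+) m ` {..<n}"
      by (simp add: lessThan_atLeast0 image_add_atLeastLessThan ivl_disj_un_two(3) add.commute)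
    then show ?thesis
      using entropy_name_Un[of "{..<m}" "(+) m ` {..<n}"] entropy_name_shift[of "{..<n}" m] by simp
  qed
  moreover have "0 \<le> \<H>(name {..<n})" for n
    by (rule entropy_simple_nonneg[OF name_simple]) simp
  ultimately obtain L where L: "(\<lambda>n. \<H>(name {..<n}) / real n) \<longlonglongrightarrow> L"
      "\<And>n. n \<ge> 1 \<Longrightarrow> L \<le> \<H>(name {..<n}) / real n"
    by (rule subadditive_quotient_limit) (rule that)
  have rate: "entropy_rate = L" unfolding entropy_rate_def by (rule limI[OF L(1)])
  show "(\<lambda>n. \<H>(name {..<n}) / real n) \<longlonglongrightarrow> entropy_rate"
    unfolding rate by (rule L(1))
  show "entropy_rate \<le> \<H>(name {..<n}) / real n" if "n \<ge> 1"
    unfolding rate by (rule L(2)[OF that])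
qed

(* The q translates of the progression {q i | i < n} by j < q tile {..<q n}. *)
lemma entropy_rate_le_progression:
  assumes "q \<ge> 1"
  shows "real n * entropy_rate \<le> \<H>(name ((*) q ` {..<n}))"
proof (cases "n = 0")
  case True
  then show ?thesis using entropy_simple_nonneg[OF name_simple[of "{}"]] by simp
next
  case False
  let ?I = "(*) q ` {..<n}"
  have union: "\<H>(name (\<Union>j<r. (+) j ` ?I)) \<le> real r * \<H>(name ?I)" if "r \<ge> 1" for r
    using that
  proof (induction r rule: nat_induct_at_least)
    case base
    then show ?case using entropy_name_shift[of ?I 0] by (simp add: lessThan_Suc)
  next
    case (Suc r)
    have "(\<Union>j<Suc r. (+) j ` ?I) = (\<Union>j<r. (+) j ` ?I) \<union> (+) r ` ?I"
      by (auto simp: lessThan_Suc)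
    then have "\<H>(name (\<Union>j<Suc r. (+) j ` ?I)) \<le> \<H>(name (\<Union>j<r. (+) j ` ?I)) + \<H>(name ((+) r ` ?I))"
      by (simp only:) (intro entropy_name_Un, auto)
    also have "\<dots> \<le> real r * \<H>(name ?I) + \<H>(name ?I)"
      using Suc.IH entropy_name_shift[of ?I r] by (intro add_mono) auto
    finally show ?case by (simp add: algebra_simps)
  qed
  have "{..<q * n} = (\<Union>j<q. (+) j ` ?I)"
  proof (intro equalityI subsetI)
    fix i assume "i \<in> {..<q * n}"
    then have lt: "i mod q < q" "i div q < n"
      using assms by (auto simp: less_mult_imp_div_less mult.commute)
    have "i \<in> (+) (i mod q) ` ?I"
      using lt(2) by (intro image_eqI[where x="q * (i div q)"] imageI) auto
    then show "i \<in> (\<Union>j<q. (+) j ` ?I)"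
      using lt(1) by (intro UN_I[of "i mod q"]) auto
  next
    fix i assume "i \<in> (\<Union>j<q. (+) j ` ?I)"
    then obtain j k where "j < q" "k < n" "i = j + q * k" by auto
    moreover from this have "q * (k + 1) \<le> q * n" by (intro mult_left_mono) auto
    ultimately show "i \<in> {..<q * n}" by simp
  qed
  then have "\<H>(name {..<q * n}) \<le> real q * \<H>(name ?I)"
    using union[OF assms] by simp
  moreover have "real (q * n) * entropy_rate \<le> \<H>(name {..<q * n})"
    using entropy_rate_le[of "q * n"] assms False by (simp add: pos_le_divide_eq mult.commute)
  ultimately have "real q * (real n * entropy_rate) \<le> real q * \<H>(name ?I)" by simp
  then show ?thesis using assms by simp
qed

end

section \<open>Partitions as labellings\<close>

text \<open>The labels are the cells themselves; this is how results on labellings reach the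
  partitions in the definition of entropy.\<close>

definition cell_of :: "'a set set \<Rightarrow> 'a \<Rightarrow> 'a set" where
  "cell_of P x = (THE A. A \<in> P \<and> x \<in> A)"

lemma cell_of:
  assumes "partition_on UNIV P"
  shows cell_of_in: "cell_of P x \<in> P" and in_cell_of: "x \<in> cell_of P x"
    and cell_of_eq: "A \<in> P \<Longrightarrow> x \<in> A \<Longrightarrow> cell_of P x = A"
proof -
  have "x \<in> \<Union>P" using assms by (simp add: partition_on_def)
  then obtain B where B: "B \<in> P" "x \<in> B" by (rule UnionE)
  have unique: "A = B" if "A \<in> P" "x \<in> A" for A
  proof (rule ccontr)
    assume "A \<noteq> B"
    then have "A \<inter> B = {}"
      using partition_onD2[OF assms] that(1) B(1) by (rule disjointD[rotated 3])
    then show False using that(2) B(2) by (simp add: disjoint_iff)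
  qed
  have eq: "cell_of P x = B"
    unfolding cell_of_def
  proof (rule the_equality)
    show "B \<in> P \<and> x \<in> B" using B ..
    show "A = B" if "A \<in> P \<and> x \<in> A" for A
      using that by (intro unique) simp_all
  qed
  show "cell_of P x \<in> P" "x \<in> cell_of P x"
    unfolding eq by (rule B)+
  show "cell_of P x = A" if "A \<in> P" "x \<in> A"
    unfolding eq by (rule unique[OF that, symmetric])
qed

context invariant_system
begin

lemma labelled_system_cell_of:
  assumes P: "finite_measurable_partition M P"
  shows "labelled_system M T (cell_of P)"
proof unfold_locales
  have part: "partition_on UNIV P" using P by (simp add: finite_measurable_partition_def)
  have "cell_of P -` {cell_of P x} \<in> sets M" for x
  proof -
    have "cell_of P -` {cell_of P x} = cell_of P x"
    proof (intro equalityI subsetI)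
      fix y assume "y \<in> cell_of P -` {cell_of P x}"
      then show "y \<in> cell_of P x" using in_cell_of[OF part, of y] by simp
    next
      fix y assume "y \<in> cell_of P x"
      then show "y \<in> cell_of P -` {cell_of P x}"
        using cell_of_eq[OF part cell_of_in[OF part, of x]] by simp
    qed
    then show ?thesis
      using P cell_of_in[OF part, of x] by (auto simp: finite_measurable_partition_def)
  qed
  moreover have "finite (range (cell_of P))"
    using P cell_of_in[OF part]
    by (intro finite_subset[of "range (cell_of P)" P]) (auto simp: finite_measurable_partition_def)
  ultimately show "simple_function M (cell_of P)"
    by (auto simp: simple_function_def)
qed

text \<open>The members of the join are exactly the fibres of names, and distinct names have
  distinct fibres, so for every n both entropies are the same sum.\<close>

lemma entropy_wrt_partition_eq:
  assumes P: "finite_measurable_partition M P"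
  shows "entropy_wrt_partition M T P = labelled_system.entropy_rate M T (cell_of P)"
proof -
  interpret labelled_system M T "cell_of P" by (rule labelled_system_cell_of[OF P])
  have part: "partition_on UNIV P" using P by (simp add: finite_measurable_partition_def)
  have "partition_entropy M (dynamical_join M T P n) = \<H>(name {..<n})" for n
  proof -
    let ?f = "\<lambda>b. name {..<n} -` {b}"
    have cell: "UNIV \<inter> (\<Inter>i<n. (T ^^ i) -` A i) = ?f (name {..<n} x)"
      if "\<forall>i<n. A i \<in> P" "x \<in> (\<Inter>i<n. (T ^^ i) -` A i)" for A x
    proof -
      have mem: "z \<in> A i \<longleftrightarrow> cell_of P z = A i" if "i < n" for z i
        using in_cell_of[OF part, of z] cell_of_eq[OF part, of "A i" z] that \<open>\<forall>i<n. A i \<in> P\<close>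
        by auto
      have "cell_of P ((T ^^ i) x) = A i" if "i < n" for i
        using mem[OF that, of "(T ^^ i) x"] that \<open>x \<in> _\<close> by auto
      then have "y \<in> (\<Inter>i<n. (T ^^ i) -` A i) \<longleftrightarrow> name {..<n} y = name {..<n} x" for y
        using mem by (simp add: name_eq_iff)
      then show ?thesis by auto
    qed
    have "dynamical_join M T P n = ?f ` range (name {..<n})"
    proof (intro equalityI subsetI)
      fix C assume "C \<in> dynamical_join M T P n"
      then obtain A where A: "C = UNIV \<inter> (\<Inter>i<n. (T ^^ i) -` A i)" "\<forall>i<n. A i \<in> P" "C \<noteq> {}"
        by (auto simp: dynamical_join_def)
      then obtain x where "x \<in> (\<Inter>i<n. (T ^^ i) -` A i)" by auto
      from cell[OF A(2) this] show "C \<in> ?f ` range (name {..<n})"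
        unfolding A(1) by (simp only: image_eqI rangeI)
    next
      fix C assume "C \<in> ?f ` range (name {..<n})"
      then obtain x where C: "C = ?f (name {..<n} x)" by blast
      have "UNIV \<inter> (\<Inter>i<n. (T ^^ i) -` cell_of P ((T ^^ i) x)) = C"
        unfolding C using cell_of_in[OF part] in_cell_of[OF part] by (intro cell) auto
      moreover have "C \<noteq> {}" using C by auto
      ultimately show "C \<in> dynamical_join M T P n"
        unfolding dynamical_join_def using cell_of_in[OF part]
        by (auto intro!: exI[of _ "\<lambda>i. cell_of P ((T ^^ i) x)"])
    qed
    moreover have "inj_on ?f (range (name {..<n}))"
      by (auto simp: inj_on_def)
    ultimately show ?thesis
      using entropy_simple_eq_sum[OF name_simple[of "{..<n}"]]
      by (simp add: partition_entropy_def sum.reindex)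
  qed
  then show ?thesis by (simp add: entropy_wrt_partition_def entropy_rate_def)
qed

end

section \<open>The lower bound\<close>

text \<open>The weight of a word is a product of letter weights: 1 - \<eta> for the predicted letter
  and \<eta> / card A for every other one. The sum over words factorises, and each factor is at most
  1 whether or not the predicted letter belongs to A.\<close>

lemma sum_prod_code_weight_le_1:
  fixes z :: "'i \<Rightarrow> 'b" and \<eta> :: real
  assumes "finite I" "finite A" "A \<noteq> {}" "0 < \<eta>" "\<eta> < 1"
  shows "(\<Sum>b\<in>I \<rightarrow>\<^sub>E A. \<Prod>i\<in>I. if b i = z i then 1 - \<eta> else \<eta> / real (card A)) \<le> 1"
proof -
  have le: "(\<Sum>a\<in>A. if a = z i then 1 - \<eta> else \<eta> / real (card A)) \<le> 1" for i
  proof -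
    have "(\<Sum>a\<in>A. if a = z i then 1 - \<eta> else \<eta> / real (card A)) \<le>
        (\<Sum>a\<in>A. (if a = z i then 1 - \<eta> else 0) + \<eta> / real (card A))"
      using assms by (intro sum_mono) auto
    also have "\<dots> = (if z i \<in> A then 1 - \<eta> else 0) + \<eta>"
      using assms by (simp add: sum.distrib)
    also have "\<dots> \<le> 1" using assms by simp
    finally show ?thesis .
  qed
  have "(\<Sum>b\<in>I \<rightarrow>\<^sub>E A. \<Prod>i\<in>I. if b i = z i then 1 - \<eta> else \<eta> / real (card A)) =
      (\<Prod>i\<in>I. \<Sum>a\<in>A. if a = z i then 1 - \<eta> else \<eta> / real (card A))"
    using assms by (intro prod_sum_PiE[symmetric]) auto
  also have "\<dots> \<le> 1"
  proof (intro prod_le_1 conjI le)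
    fix i
    show "0 \<le> (\<Sum>a\<in>A. if a = z i then 1 - \<eta> else \<eta> / real (card A))"
      using assms by (intro sum_nonneg) auto
  qed
  finally show ?thesis .
qed

context labelled_system
begin

definition num_labels :: real where
  "num_labels = real (card (range l))"

lemma num_labels_ge_1: "num_labels \<ge> 1"
proof -
  have "card (range l) > 0"
    using simple_range_finite[OF l_simple] by (simp add: card_gt_0_iff)
  then show ?thesis by (simp add: num_labels_def)
qed

(* The name of y is encoded by a centre x c together with the few times i at which its coarse label
   \<beta> (T^i (x c)) differs from the label of T^i y; the second summand of the numerator encodes the names of points outside G. *)
lemma entropy_name_le_cover_sum:
  fixes D :: "'c \<Rightarrow> 'a \<Rightarrow> nat \<Rightarrow> real"
  assumes I: "finite I" and \<eta>: "0 < \<eta>" "\<eta> < 1" and r: "0 < r" and \<gamma>: "0 \<le> \<gamma>" and \<epsilon>: "0 \<le> \<epsilon>"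
    and \<phi>: "\<phi> \<in> borel_measurable M" "\<And>x. \<bar>\<phi> x\<bar> \<le> B"
    and sets: "K \<in> sets M" "G \<in> sets M"
    and C: "finite C" "C \<noteq> {}"
    and D_nonneg: "\<And>c y i. 0 \<le> D c y i"
    and coarse: "\<And>c y i. c \<in> C \<Longrightarrow> i \<in> I \<Longrightarrow> D c y i < r \<Longrightarrow> (T ^^ i) y \<in> K \<Longrightarrow>
      \<beta> ((T ^^ i) (x c)) = l ((T ^^ i) y)"
    and osc: "\<And>c y i. c \<in> C \<Longrightarrow> i \<in> I \<Longrightarrow> D c y i < r \<Longrightarrow>
      \<bar>\<phi> ((T ^^ i) (x c)) - \<phi> ((T ^^ i) y)\<bar> \<le> \<gamma>"
    and cover: "\<And>y. y \<in> G \<Longrightarrow> \<exists>c\<in>C. (\<Sum>i\<in>I. D c y i) \<le> real (card I) * \<epsilon>"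
  defines "Z \<equiv> \<Sum>c\<in>C. exp (\<Sum>i\<in>I. \<phi> ((T ^^ i) (x c)))"
    and "\<Lambda> \<equiv> ln (num_labels / \<eta>)"
  shows "\<H>(name I) \<le> ln Z + ln 2 + real (card I) *
    (- (\<integral>x. \<phi> x \<partial>M) + \<gamma> - ln (1 - \<eta>) + \<epsilon> * ((2 * B + \<Lambda>) / r)
      + prob (- K) * \<Lambda> + prob (- G) * (2 * B + ln num_labels))"
proof -
  define n where "n = real (card I)"
  define m where "m = num_labels"
  have m: "m \<ge> 1" using num_labels_ge_1 by (simp add: m_def)
  have "n \<ge> 0" by (simp add: n_def)
  have "B \<ge> 0" using \<phi>(2)[of undefined] by linarith
  have \<Lambda>: "\<Lambda> = ln m - ln \<eta>" using m \<eta> by (simp add: \<Lambda>_def m_def ln_div)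
  have "ln m \<ge> 0" using m by simp
  have "ln \<eta> \<le> 0" "ln (1 - \<eta>) \<le> 0" using \<eta> by simp_all
  then have "\<Lambda> \<ge> 0" using \<Lambda> \<open>ln m \<ge> 0\<close> by simp
  define S where "S = (\<lambda>y. \<Sum>i\<in>I. \<phi> ((T ^^ i) y))"
  have S_abs: "\<bar>S y\<bar> \<le> n * B" for y
  proof -
    have "\<bar>S y\<bar> \<le> (\<Sum>i\<in>I. \<bar>\<phi> ((T ^^ i) y)\<bar>)" unfolding S_def by (rule sum_abs)
    also have "\<dots> \<le> (\<Sum>i\<in>I. B)" by (intro sum_mono \<phi>(2))
    finally show ?thesis by (simp add: n_def)
  qed
  \<comment> \<open>The code for names given a centre: a correct letter costs - ln (1 - \<eta>), a
    wrong one \<Lambda> = ln (m / \<eta>).\<close>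
  define \<kappa> where "\<kappa> = (\<lambda>b c. \<Prod>i\<in>I. if b i = \<beta> ((T ^^ i) (x c)) then 1 - \<eta> else \<eta> / m)"
  have \<kappa>_pos: "0 < \<kappa> b c" for b c
    unfolding \<kappa>_def using \<eta> m by (intro prod_pos) auto
  define num where "num = (\<lambda>b. (\<Sum>c\<in>C. exp (S (x c)) * \<kappa> b c) + exp (- (n * B)) * (1 / m) ^ card I)"
  have Z: "Z = (\<Sum>c\<in>C. exp (S (x c)))" by (simp add: Z_def S_def)
  \<comment> \<open>The weight of the uniform code bounds every exp (S y) from below, hence is at
    most Z. The normalising constant is then at most 2 Z, which is where ln 2 comes from.\<close>
  have Z_ge: "exp (- (n * B)) \<le> Z"
  proof -
    obtain c where "c \<in> C" using C by blast
    have "exp (- (n * B)) \<le> exp (S (x c))" using S_abs[of "x c"] by simp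
    also have "\<dots> \<le> Z" unfolding Z using C \<open>c \<in> C\<close> by (intro member_le_sum) auto
    finally show ?thesis .
  qed
  have Z_pos: "0 < Z" using Z_ge by (rule less_le_trans[rotated]) simp
  define w where "w = (\<lambda>b. num b / (Z + exp (- (n * B))))"
  have num_pos: "0 < num b" for b
    unfolding num_def using m \<kappa>_pos by (intro add_nonneg_pos sum_nonneg) (auto intro: less_imp_le)
  have w_pos: "0 < w b" for b
    unfolding w_def using num_pos Z_pos by (intro divide_pos_pos add_pos_pos) auto
  have fin: "finite (range l)" by (rule simple_range_finite[OF l_simple])
  have \<kappa>_total: "(\<Sum>b\<in>I \<rightarrow>\<^sub>E range l. \<kappa> b c) \<le> 1" for c
    unfolding \<kappa>_def m_def num_labels_def
    using sum_prod_code_weight_le_1[OF I fin _ \<eta>, of "\<lambda>i. \<beta> ((T ^^ i) (x c))"] by simp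
  have uniform: "(\<Sum>b\<in>I \<rightarrow>\<^sub>E range l. (1 / m) ^ card I) = 1"
    using m I by (simp add: card_PiE m_def num_labels_def power_divide)
  have "(\<Sum>b\<in>I \<rightarrow>\<^sub>E range l. num b) =
      (\<Sum>c\<in>C. exp (S (x c)) * (\<Sum>b\<in>I \<rightarrow>\<^sub>E range l. \<kappa> b c)) + exp (- (n * B))"
    unfolding num_def sum.distrib sum_distrib_left[symmetric] uniform
    by (subst sum.swap) (simp add: sum_distrib_left)
  also have "\<dots> \<le> (\<Sum>c\<in>C. exp (S (x c)) * 1) + exp (- (n * B))"
    using \<kappa>_total by (intro add_right_mono sum_mono mult_left_mono) auto
  finally have num_total: "(\<Sum>b\<in>I \<rightarrow>\<^sub>E range l. num b) \<le> Z + exp (- (n * B))"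
    by (simp add: Z)
  have "(\<Sum>b\<in>range (name I). w b) \<le> (\<Sum>b\<in>I \<rightarrow>\<^sub>E range l. w b)"
    using finite_names[OF I] name_in_PiE w_pos by (intro sum_mono2) (auto intro: less_imp_le)
  also have "\<dots> \<le> 1"
    unfolding w_def sum_divide_distrib[symmetric]
    using num_total Z_pos by (simp add: add_pos_pos)
  finally have w_total: "(\<Sum>b\<in>range (name I). w b) \<le> 1" .
  \<comment> \<open>R collects the costs: \<gamma> and - ln (1 - \<eta>) at every time, 2 B +
    \<Lambda> at times with D at least r, \<Lambda> at visits to - K, and 2 B + ln m per time for
    points off G. The number of times with D at least r appears as n \<epsilon> / r, its bound from
    the cover.\<close>
  define R where "R = (\<lambda>y. - S y + n * (\<gamma> - ln (1 - \<eta>) + \<epsilon> * ((2 * B + \<Lambda>) / r))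
    + \<Lambda> * (\<Sum>i\<in>I. indicator (- K) ((T ^^ i) y)) + indicator (- G) y * (n * (2 * B + ln m)))"
  have pointwise: "- ln (num (name I y)) \<le> R y" for y
  proof (cases "y \<in> G")
    case True
    then obtain c where c: "c \<in> C" "(\<Sum>i\<in>I. D c y i) \<le> n * \<epsilon>" using cover n_def by auto
    \<comment> \<open>The quotient D / r is at least 1 at far times and nonnegative otherwise, so it
      stands in for their indicator: Markov's inequality, carried out time by time.\<close>
    have step: "\<phi> ((T ^^ i) y) - \<gamma> - 2 * B * (D c y i / r) + (ln (1 - \<eta>) - (D c y i / r) * \<Lambda>
        - indicator (- K) ((T ^^ i) y) * \<Lambda>) \<le> \<phi> ((T ^^ i) (x c)) +
        ln (if name I y i = \<beta> ((T ^^ i) (x c)) then 1 - \<eta> else \<eta> / m)" if i: "i \<in> I" for i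
    proof -
      define d where "d = D c y i / r"
      define e where "e = (indicator (- K) ((T ^^ i) y) :: real)"
      have de: "0 \<le> d" "0 \<le> e"
        using D_nonneg r by (auto simp: d_def e_def)
      have far: "1 \<le> d" if "\<not> D c y i < r"
        using that r by (simp add: d_def)
      have "\<phi> ((T ^^ i) y) - \<gamma> - 2 * B * d \<le> \<phi> ((T ^^ i) (x c))"
      proof (cases "D c y i < r")
        case True
        have "0 \<le> 2 * B * d" using de \<open>B \<ge> 0\<close> by simp
        then show ?thesis using osc[OF c(1) i True] by linarith
      next
        case False
        then have "2 * B * 1 \<le> 2 * B * d" using far \<open>B \<ge> 0\<close> by (intro mult_left_mono) auto
        then show ?thesis using \<phi>(2)[of "(T ^^ i) y"] \<phi>(2)[of "(T ^^ i) (x c)"] \<gamma> by linarith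
      qed
      moreover have "ln (1 - \<eta>) - d * \<Lambda> - e * \<Lambda> \<le>
        ln (if name I y i = \<beta> ((T ^^ i) (x c)) then 1 - \<eta> else \<eta> / m)"
      proof (cases "name I y i = \<beta> ((T ^^ i) (x c))")
        case True
        moreover have "0 \<le> d * \<Lambda>" "0 \<le> e * \<Lambda>" using de \<open>\<Lambda> \<ge> 0\<close> by simp_all
        ultimately show ?thesis by simp
      next
        case False
        then have "l ((T ^^ i) y) \<noteq> \<beta> ((T ^^ i) (x c))" using i by (simp add: name_def)
        \<comment> \<open>A wrong prediction has one of two causes, a far time or a visit outside K,
          so d + e reaches 1 and pays for \<Lambda>.\<close>
        then have "\<not> D c y i < r \<or> (T ^^ i) y \<notin> K" using coarse[OF c(1) i] by fastforce
        moreover have "e = 1" if "(T ^^ i) y \<notin> K" using that by (simp add: e_def)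
        ultimately have "1 \<le> d + e" using far de by linarith
        then have "1 * \<Lambda> \<le> (d + e) * \<Lambda>" using \<open>\<Lambda> \<ge> 0\<close> by (intro mult_right_mono)
        moreover have "ln (\<eta> / m) = - \<Lambda>" using m \<eta> \<Lambda> by (simp add: ln_div)
        ultimately show ?thesis
          using False \<open>ln (1 - \<eta>) \<le> 0\<close> by (simp add: algebra_simps)
      qed
      ultimately show ?thesis unfolding d_def e_def by linarith
    qed
    have "S y - n * \<gamma> - 2 * B * ((\<Sum>i\<in>I. D c y i) / r) + (n * ln (1 - \<eta>) - ((\<Sum>i\<in>I. D c y i) / r) * \<Lambda>
        - (\<Sum>i\<in>I. indicator (- K) ((T ^^ i) y)) * \<Lambda>) \<le> S (x c) + ln (\<kappa> (name I y) c)"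
    proof -
      have "ln (\<kappa> (name I y) c) =
        (\<Sum>i\<in>I. ln (if name I y i = \<beta> ((T ^^ i) (x c)) then 1 - \<eta> else \<eta> / m))"
        unfolding \<kappa>_def using I \<eta> m by (intro ln_prod) auto
      then show ?thesis
        using sum_mono[OF step]
        by (simp add: S_def sum.distrib sum_subtractf sum_distrib_left sum_distrib_right
            sum_divide_distrib n_def)
    qed
    moreover have "(\<Sum>i\<in>I. D c y i) / r * (2 * B + \<Lambda>) \<le> n * \<epsilon> / r * (2 * B + \<Lambda>)"
      using c(2) r \<open>B \<ge> 0\<close> \<open>\<Lambda> \<ge> 0\<close> by (intro mult_right_mono divide_right_mono) auto
    moreover have "S (x c) + ln (\<kappa> (name I y) c) \<le> ln (num (name I y))"
    proof -
      have "exp (S (x c)) * \<kappa> (name I y) c \<le> (\<Sum>c\<in>C. exp (S (x c)) * \<kappa> (name I y) c)"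
        using C c(1) \<kappa>_pos by (intro member_le_sum) (auto intro: less_imp_le)
      also have "\<dots> \<le> num (name I y)" unfolding num_def using m by simp
      finally have "ln (exp (S (x c)) * \<kappa> (name I y) c) \<le> ln (num (name I y))"
        using \<kappa>_pos num_pos by (subst ln_le_cancel_iff) auto
      then show ?thesis using \<kappa>_pos[of "name I y" c] by (simp add: ln_mult)
    qed
    ultimately show ?thesis
      using True by (simp add: R_def algebra_simps add_divide_distrib)
  next
    case False
    \<comment> \<open>Off G the uniform code is used, at cost n B + n ln m; the second n B in R
      compensates its term - S y.\<close>
    have "exp (- (n * B)) * (1 / m) ^ card I \<le> num (name I y)"
      unfolding num_def using \<kappa>_pos by (simp add: sum_nonneg less_imp_le)
    then have "ln (exp (- (n * B)) * (1 / m) ^ card I) \<le> ln (num (name I y))"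
      using m num_pos by (subst ln_le_cancel_iff) auto
    moreover have "ln (exp (- (n * B)) * (1 / m) ^ card I) = - (n * B) - n * ln m"
      using m by (simp add: ln_mult ln_realpow ln_div n_def)
    moreover have "0 \<le> n * (\<gamma> - ln (1 - \<eta>) + \<epsilon> * ((2 * B + \<Lambda>) / r))"
      using \<gamma> \<epsilon> r \<open>B \<ge> 0\<close> \<open>\<Lambda> \<ge> 0\<close> \<open>n \<ge> 0\<close> \<open>ln (1 - \<eta>) \<le> 0\<close>
      by (intro mult_nonneg_nonneg add_nonneg_nonneg) auto
    moreover have "0 \<le> \<Lambda> * (\<Sum>i\<in>I. indicator (- K) ((T ^^ i) y))"
      using \<open>\<Lambda> \<ge> 0\<close> by (intro mult_nonneg_nonneg sum_nonneg) auto
    moreover have "indicator (- G) y * (n * (2 * B + ln m)) = n * B + n * B + n * ln m"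
      using False by (simp add: algebra_simps)
    ultimately show ?thesis
      using S_abs[of y] unfolding R_def by linarith
  qed
  have "- ln (w (name I y)) \<le> ln Z + ln 2 + R y" for y
  proof -
    have "ln (Z + exp (- (n * B))) \<le> ln (2 * Z)"
      using Z_ge Z_pos by (subst ln_le_cancel_iff) (auto simp: add_pos_pos)
    also have "\<dots> = ln 2 + ln Z" using Z_pos by (simp add: ln_mult)
    finally have "ln (Z + exp (- (n * B))) \<le> ln 2 + ln Z" .
    moreover have "0 < Z + exp (- (n * B))" using Z_pos by (simp add: add_pos_pos)
    then have "ln (w (name I y)) = ln (num (name I y)) - ln (Z + exp (- (n * B)))"
      unfolding w_def using num_pos[of "name I y"] by (intro ln_divide_pos)
    ultimately show ?thesis
      using pointwise[of y] by linarith
  qed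
  moreover have int_\<phi>: "integrable M \<phi>"
    using \<phi> by (intro integrable_const_bound[where B=B]) auto
  have int_S: "integrable M S" "(\<integral>y. S y \<partial>M) = n * (\<integral>x. \<phi> x \<partial>M)"
    unfolding S_def using int_\<phi> \<phi>(1)
    by (auto intro!: Bochner_Integration.integrable_sum integrable_T_pow
        simp: Bochner_Integration.integral_sum integrable_T_pow integral_T_pow n_def)
  have int_K: "integrable M (\<lambda>y. indicator (- K) ((T ^^ i) y) :: real)"
      "(\<integral>y. indicator (- K) ((T ^^ i) y) \<partial>M) = prob (- K)" for i
  proof -
    have "- K \<in> sets M" using sets.compl_sets[OF sets(1)] by (simp add: Compl_eq_Diff_UNIV)
    then have "integrable M (indicator (- K) :: 'a \<Rightarrow> real)" "(\<integral>y. indicator (- K) y \<partial>M) = prob (- K)"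
      by (auto simp: emeasure_eq_measure)
    then show "integrable M (\<lambda>y. indicator (- K) ((T ^^ i) y) :: real)"
      "(\<integral>y. indicator (- K) ((T ^^ i) y) \<partial>M) = prob (- K)"
      by (auto intro!: integrable_T_pow simp: integral_T_pow)
  qed
  have int_G: "integrable M (indicator (- G) :: 'a \<Rightarrow> real)" "(\<integral>y. indicator (- G) y \<partial>M) = prob (- G)"
  proof -
    have "- G \<in> sets M" using sets.compl_sets[OF sets(2)] by (simp add: Compl_eq_Diff_UNIV)
    then show "integrable M (indicator (- G) :: 'a \<Rightarrow> real)" "(\<integral>y. indicator (- G) y \<partial>M) = prob (- G)"
      by (auto simp: emeasure_eq_measure)
  qed
  have int_R: "integrable M R"
    unfolding R_def using int_S int_K int_G
    by (intro Bochner_Integration.integrable_add Bochner_Integration.integrable_minus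
        integrable_mult_right integrable_mult_left Bochner_Integration.integrable_sum) auto
  have "(\<integral>y. R y \<partial>M) = - (n * (\<integral>x. \<phi> x \<partial>M)) + n * (\<gamma> - ln (1 - \<eta>) + \<epsilon> * ((2 * B + \<Lambda>) / r))
      + \<Lambda> * (n * prob (- K)) + prob (- G) * (n * (2 * B + ln m))"
    unfolding R_def using int_S int_K int_G
    by (simp add: Bochner_Integration.integral_sum n_def)
  moreover have "\<H>(name I) \<le> (\<integral>y. - ln (w (name I y)) \<partial>M)"
    using w_pos w_total by (intro entropy_le_cross_entropy name_simple I) auto
  moreover have "(\<integral>y. - ln (w (name I y)) \<partial>M) \<le> (\<integral>y. ln Z + ln 2 + R y \<partial>M)"
    using calculation(1) int_R integral_simple_compose(1)[OF name_simple[OF I], of "\<lambda>b. - ln (w b)"]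
    by (intro integral_mono) auto
  moreover have "(\<integral>y. ln Z + ln 2 + R y \<partial>M) = ln Z + ln 2 + (\<integral>y. R y \<partial>M)"
    using int_R by simp
  ultimately show ?thesis
    by (simp add: n_def m_def algebra_simps)
qed

end

section \<open>Balls of the averaged metrics and the infima over centres and steps\<close>

lemma continuous_on_funpow:
  fixes T :: "'a::topological_space \<Rightarrow> 'a"
  assumes "continuous_on UNIV T"
  shows "continuous_on UNIV (T ^^ n)"
proof (induction n)
  case (Suc n)
  then show ?case
    using continuous_on_compose[OF Suc continuous_on_subset[OF assms]] by simp
qed (simp add: id_def)

lemma max_mean_dist_less_iff:
  assumes "n \<ge> 1"
  shows "max_mean_dist T q n x y < \<epsilon> \<longleftrightarrow> (\<forall>k\<in>{1..n}. mean_dist T q k x y < \<epsilon>)"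
  using assms unfolding max_mean_dist_def by (subst Max_less_iff) auto

text \<open>A Bowen ball, given by closeness at each single time, lies in the ball for averages:
  every average of numbers below \<epsilon> is below \<epsilon>.\<close>

lemma max_mean_ballI:
  assumes "n \<ge> 1" and close: "\<And>i. i < n \<Longrightarrow> dist ((T ^^ (q * i)) x) ((T ^^ (q * i)) y) < \<epsilon>"
  shows "y \<in> max_mean_ball T q n x \<epsilon>"
proof -
  have "mean_dist T q k x y < \<epsilon>" if "k \<in> {1..n}" for k
  proof -
    have "(\<Sum>i<k. dist ((T ^^ (q * i)) x) ((T ^^ (q * i)) y)) < (\<Sum>i<k. \<epsilon>)"
      using that close by (intro sum_strict_mono) (auto simp: lessThan_empty_iff)
    then show ?thesis using that by (simp add: mean_dist_def pos_divide_less_eq mult.commute)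
  qed
  then show ?thesis
    using assms(1) by (simp add: max_mean_ball_def max_mean_dist_less_iff)
qed

lemma open_max_mean_ball:
  assumes T: "continuous_on UNIV T" and "n \<ge> 1"
  shows "open (max_mean_ball T q n x \<epsilon>)"
proof -
  have "open {y. mean_dist T q k x y < \<epsilon>}" for k
    unfolding mean_dist_def divide_inverse
    by (intro open_Collect_less continuous_intros continuous_on_funpow[OF T])
  then have "open (\<Inter>k\<in>{1..n}. {y. mean_dist T q k x y < \<epsilon>})"
    by (intro open_INT) auto
  moreover have "max_mean_ball T q n x \<epsilon> = (\<Inter>k\<in>{1..n}. {y. mean_dist T q k x y < \<epsilon>})"
    using max_mean_dist_less_iff[OF assms(2), of T q x _ \<epsilon>]
    by (auto simp: max_mean_ball_def)
  ultimately show ?thesis by (simp only:)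
qed

text \<open>Compactness supplies an admissible family of centres for every q, so that the infimum
  defining \<open>S_max_mean\<close> is taken over a nonempty set.\<close>

lemma max_mean_ball_finite_cover:
  fixes T :: "'a::metric_space \<Rightarrow> 'a"
  assumes "compact (UNIV :: 'a set)" and T: "continuous_on UNIV T" and "n \<ge> 1" "\<epsilon> > 0"
  obtains k :: nat and x :: "nat \<Rightarrow> 'a"
  where "k \<ge> 1" "(\<Union>i\<in>{1..k}. max_mean_ball T q n (x i) \<epsilon>) = UNIV"
proof -
  have "x \<in> max_mean_ball T q n x \<epsilon>" for x
    using assms by (intro max_mean_ballI) auto
  then have "UNIV \<subseteq> (\<Union>x. max_mean_ball T q n x \<epsilon>)" by blast
  then obtain C where C: "finite C" "UNIV \<subseteq> (\<Union>x\<in>C. max_mean_ball T q n x \<epsilon>)"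
    using compactE_image[OF assms(1), of UNIV "\<lambda>x. max_mean_ball T q n x \<epsilon>"]
      open_max_mean_ball[OF T \<open>n \<ge> 1\<close>] by metis
  obtain x where x: "bij_betw x {1..card C} C"
    using ex_bij_betw_nat_finite_1[OF C(1)] by blast
  have "C \<noteq> {}" using C(2) by auto
  then have "card C \<ge> 1" using C(1) by (simp add: Suc_le_eq card_gt_0_iff)
  moreover have "(\<Union>i\<in>{1..card C}. max_mean_ball T q n (x i) \<epsilon>) = UNIV"
  proof -
    have "(\<Union>i\<in>{1..card C}. max_mean_ball T q n (x i) \<epsilon>) =
        (\<Union>z\<in>x ` {1..card C}. max_mean_ball T q n z \<epsilon>)" by simp
    also have "\<dots> = (\<Union>z\<in>C. max_mean_ball T q n z \<epsilon>)"
      by (simp only: bij_betw_imp_surj_on[OF x])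
    finally show ?thesis using C(2) by (simp only: top.extremum_unique)
  qed
  ultimately show thesis by (rule that)
qed

lemma S_hat_lower_bound:
  fixes T :: "'a::metric_space \<Rightarrow> 'a"
  assumes "compact (UNIV :: 'a set)" "continuous_on UNIV T" "n \<ge> 1" "\<epsilon> > 0" "prob_space M"
    and lower: "\<And>q k (x :: nat \<Rightarrow> 'a). q \<ge> 1 \<Longrightarrow> k \<ge> 1 \<Longrightarrow>
      1 - \<epsilon> < measure M (\<Union>i\<in>{1..k}. max_mean_ball T q n (x i) \<epsilon>) \<Longrightarrow>
      c \<le> (\<Sum>i=1..k. exp (orbit_sum T q n \<phi> (x i)))"
    and "space M = UNIV"
  shows "c \<le> S_hat T n \<phi> M \<epsilon>"
proof -
  have "c \<le> S_max_mean T q n \<phi> M \<epsilon>" if q: "q \<ge> 1" for q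
    unfolding S_max_mean_def
  proof (rule cInf_greatest)
    obtain k and x :: "nat \<Rightarrow> 'a"
      where kx: "k \<ge> 1" "(\<Union>i\<in>{1..k}. max_mean_ball T q n (x i) \<epsilon>) = UNIV"
      using max_mean_ball_finite_cover[OF assms(1-4)] .
    have "measure M (\<Union>i\<in>{1..k}. max_mean_ball T q n (x i) \<epsilon>) > 1 - \<epsilon>"
      using prob_space.prob_space[OF assms(5)] assms(4,7) kx(2) by simp
    with kx(1) show "{(\<Sum>i=1..k. exp (orbit_sum T q n \<phi> (x i))) | (k :: nat) (x :: nat \<Rightarrow> 'a).
        k \<ge> 1 \<and> measure M (\<Union>i\<in>{1..k}. max_mean_ball T q n (x i) \<epsilon>) > 1 - \<epsilon>} \<noteq> {}"
      by blast
  next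
    fix z
    assume "z \<in> {(\<Sum>i=1..k. exp (orbit_sum T q n \<phi> (x i))) | (k :: nat) (x :: nat \<Rightarrow> 'a).
        k \<ge> 1 \<and> measure M (\<Union>i\<in>{1..k}. max_mean_ball T q n (x i) \<epsilon>) > 1 - \<epsilon>}"
    then obtain k :: nat and x :: "nat \<Rightarrow> 'a"
      where z: "z = (\<Sum>i=1..k. exp (orbit_sum T q n \<phi> (x i)))" and "k \<ge> 1"
        "measure M (\<Union>i\<in>{1..k}. max_mean_ball T q n (x i) \<epsilon>) > 1 - \<epsilon>"
      by blast
    with q show "c \<le> z" unfolding z by (intro lower)
  qed
  then show ?thesis unfolding S_hat_def by (intro cINF_greatest) auto
qed

lemma S_hat_le:
  fixes T :: "'a::metric_space \<Rightarrow> 'a" and k :: nat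
  assumes "q \<ge> 1" "k \<ge> 1" "1 - \<epsilon> < measure M (\<Union>i\<in>{1..k}. max_mean_ball T q n (x i) \<epsilon>)"
  shows "S_hat T n \<phi> M \<epsilon> \<le> (\<Sum>i=1..k. exp (orbit_sum T q n \<phi> (x i)))"
proof -
  let ?V = "\<lambda>q. {(\<Sum>i=1..k. exp (orbit_sum T q n \<phi> (x i))) | (k :: nat) (x :: nat \<Rightarrow> 'a).
      k \<ge> 1 \<and> measure M (\<Union>i\<in>{1..k}. max_mean_ball T q n (x i) \<epsilon>) > 1 - \<epsilon>}"
  have nonneg: "0 \<le> z" if "z \<in> ?V q" for z q
    using that by (auto intro!: sum_nonneg)
  have "S_max_mean T q n \<phi> M \<epsilon> \<le> (\<Sum>i=1..k. exp (orbit_sum T q n \<phi> (x i)))"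
    unfolding S_max_mean_def
  proof (rule cInf_lower)
    show "bdd_below (?V q)" using nonneg by (rule bdd_belowI)
    show "(\<Sum>i=1..k. exp (orbit_sum T q n \<phi> (x i))) \<in> ?V q"
      unfolding mem_Collect_eq by (rule exI[of _ k], rule exI[of _ x]) (intro conjI refl assms)
  qed
  moreover have "S_hat T n \<phi> M \<epsilon> \<le> S_max_mean T q n \<phi> M \<epsilon>"
    unfolding S_hat_def
  proof (rule cINF_lower)
    show "bdd_below ((\<lambda>q. S_max_mean T q n \<phi> M \<epsilon>) ` {1..})"
    proof (rule bdd_belowI2)
      fix q
      \<comment> \<open>If no family is admissible for q, then \<open>S_max_mean\<close> is the
        default value \<open>Inf {}\<close>; the minimum with 0 covers this case as well.\<close>
      show "min 0 (Inf {}) \<le> S_max_mean T q n \<phi> M \<epsilon>"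
      proof (cases "?V q = {}")
        case True
        then show ?thesis unfolding S_max_mean_def by (simp only: min.cobounded2)
      next
        case False
        then have "0 \<le> S_max_mean T q n \<phi> M \<epsilon>"
          unfolding S_max_mean_def using nonneg by (rule cInf_greatest)
        then show ?thesis by simp
      qed
    qed
  qed (use assms in simp)
  ultimately show ?thesis by simp
qed


section \<open>The lower bound for a labelling of a compact space\<close>

locale borel_system = labelled_system M T l
  for M :: "'a::metric_space measure" and T and l :: "'a \<Rightarrow> 'b" +
  assumes compact_UNIV: "compact (UNIV :: 'a set)"
    and T_continuous: "continuous_on UNIV T"
    and sets_eq: "sets M = sets borel"
begin

(* The label of y in K can be read off any point within distance r: K is a union of separated closed
   subsets of the label sets. *)
lemma coarse_label_exists:
  assumes "\<delta> > 0"
  obtains K r and \<beta> :: "'a \<Rightarrow> 'b"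
  where "K \<in> sets M" "prob (- K) \<le> \<delta>" "r > 0" "\<And>x y. y \<in> K \<Longrightarrow> dist x y < r \<Longrightarrow> \<beta> x = l y"
proof -
  have fin: "finite (range l)" by (rule simple_range_finite[OF l_simple])
  have m: "num_labels \<ge> 1" by (rule num_labels_ge_1)
  have l_sets: "l -` {a} \<in> sets M" for a by (rule simple_vimage_sets[OF l_simple])
  have "\<exists>F. closed F \<and> F \<subseteq> l -` {a} \<and> prob (l -` {a} - F) \<le> \<delta> / num_labels" for a
  proof -
    have "\<delta> / num_labels > 0" using assms m by simp
    then obtain F U where FU: "closed F" "F \<subseteq> l -` {a}" "l -` {a} \<subseteq> U" "open U"
        "prob (U - F) < \<delta> / num_labels"
      using borel_closed_open_approx[OF finite_measure_axioms sets_eq l_sets] by metis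
    have "prob (l -` {a} - F) \<le> prob (U - F)"
      using FU by (intro finite_measure_mono) (auto simp: sets_eq)
    with FU show ?thesis by (intro exI[of _ F]) auto
  qed
  then obtain F where F: "\<And>a. closed (F a)" "\<And>a. F a \<subseteq> l -` {a}"
      "\<And>a. prob (l -` {a} - F a) \<le> \<delta> / num_labels"
    by metis
  have "\<exists>\<rho>>0. \<forall>x\<in>F a. \<forall>y\<in>(\<Union>b\<in>range l - {a}. F b). \<rho> \<le> dist x y" for a
  proof (rule separate_disjoint_compacts)
    show "compact (F a)"
      using compact_Int_closed[OF compact_UNIV F(1)[of a]] by simp
    show "closed (\<Union>b\<in>range l - {a}. F b)"
      using fin F(1) by (intro closed_UN) auto
    show "F a \<inter> (\<Union>b\<in>range l - {a}. F b) = {}"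
    proof (rule equals0I)
      fix z assume "z \<in> F a \<inter> (\<Union>b\<in>range l - {a}. F b)"
      then obtain b where "z \<in> F a" "b \<noteq> a" "z \<in> F b" by auto
      then have "l z = a" "l z = b" using F(2)[of a] F(2)[of b] by auto
      with \<open>b \<noteq> a\<close> show False by simp
    qed
  qed
  then obtain \<rho> where \<rho>: "\<And>a. \<rho> a > 0"
      "\<And>a x y. x \<in> F a \<Longrightarrow> y \<in> (\<Union>b\<in>range l - {a}. F b) \<Longrightarrow> \<rho> a \<le> dist x y"
    by metis
  \<comment> \<open>Half the least separation: a point within r of two different closed pieces would
    put them at distance below 2 r.\<close>
  define r where "r = Min (\<rho> ` range l) / 2"
  have r_le: "2 * r \<le> \<rho> a" if "a \<in> range l" for a
    unfolding r_def using fin that by simp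
  have "r > 0" unfolding r_def using fin \<rho>(1) by (subst pos_less_divide_eq) (auto simp: Min_gr_iff)
  define K where "K = (\<Union>a\<in>range l. F a)"
  \<comment> \<open>Some label whose closed piece comes within r of x. Within distance r of K there
    is exactly one; elsewhere the value is arbitrary.\<close>
  define \<beta> where "\<beta> = (\<lambda>x. SOME a. a \<in> range l \<and> (\<exists>y\<in>F a. dist x y < r))"
  have K_sets: "K \<in> sets M"
    unfolding K_def sets_eq using fin F(1) by (intro sets.finite_UN) auto
  have K_small: "prob (- K) \<le> \<delta>"
  proof -
    have "prob (- K) \<le> prob (\<Union>a\<in>range l. l -` {a} - F a)"
    proof (rule finite_measure_mono)
      show "- K \<subseteq> (\<Union>a\<in>range l. l -` {a} - F a)" by (auto simp: K_def)
      show "(\<Union>a\<in>range l. l -` {a} - F a) \<in> sets M"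
        using fin l_sets F(1) by (intro sets.finite_UN sets.Diff) (auto simp: sets_eq)
    qed
    also have "\<dots> \<le> (\<Sum>a\<in>range l. prob (l -` {a} - F a))"
      using fin l_sets F(1) by (intro finite_measure_subadditive_finite) (auto simp: sets_eq)
    also have "\<dots> \<le> (\<Sum>a\<in>range l. \<delta> / num_labels)" by (intro sum_mono F(3))
    also have "\<dots> = \<delta>" using m by (simp add: num_labels_def)
    finally show ?thesis .
  qed
  have "\<beta> x = l y" if y: "y \<in> K" and near: "dist x y < r" for x y
  proof -
    obtain a where a: "a \<in> range l" "y \<in> F a" using y by (auto simp: K_def)
    then have "l y = a" using F(2)[of a] by auto
    have "a \<in> range l \<and> (\<exists>y\<in>F a. dist x y < r)" using a near by blast
    then have "\<beta> x \<in> range l \<and> (\<exists>y\<in>F (\<beta> x). dist x y < r)" unfolding \<beta>_def by (rule someI)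
    then obtain y' where y': "\<beta> x \<in> range l" "y' \<in> F (\<beta> x)" "dist x y' < r" by blast
    have "\<beta> x = a"
    proof (rule ccontr)
      assume "\<beta> x \<noteq> a"
      then have "\<rho> a \<le> dist y y'" using y' a(2) by (intro \<rho>(2)) auto
      also have "\<dots> < 2 * r" using dist_triangle3[of y y' x] near y'(3) by simp
      finally show False using r_le[OF a(1)] by simp
    qed
    then show ?thesis using \<open>l y = a\<close> by simp
  qed
  with K_sets K_small \<open>r > 0\<close> show thesis by (rule that)
qed

lemma continuous_borel_measurable: "continuous_on UNIV \<phi> \<Longrightarrow> (\<phi> :: 'a \<Rightarrow> real) \<in> borel_measurable M"
  using borel_measurable_continuous_onI[of \<phi>] measurable_cong_sets[OF sets_eq refl] by blast

lemma continuous_bounded: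
  assumes "continuous_on UNIV (\<phi> :: 'a \<Rightarrow> real)"
  obtains B where "\<And>x. \<bar>\<phi> x\<bar> \<le> B"
proof -
  have "bounded (range \<phi>)"
    using compact_imp_bounded[OF compact_continuous_image[OF assms compact_UNIV]] .
  then show thesis using that by (auto simp: bounded_iff)
qed

text \<open>Four errors get \<theta> / 4 each: the oscillation of \<phi>, the cost of correct
  predictions, the visits outside K, and everything proportional to \<epsilon>. The threshold for
  \<epsilon> depends on neither n nor q, so the bound survives the infimum over q.\<close>

lemma ln_S_hat_lower:
  fixes \<phi> :: "'a \<Rightarrow> real"
  assumes \<phi>: "continuous_on UNIV \<phi>" and \<theta>: "\<theta> > 0"
  obtains \<epsilon>0 where "\<epsilon>0 > 0" "\<And>\<epsilon> n. 0 < \<epsilon> \<Longrightarrow> \<epsilon> < \<epsilon>0 \<Longrightarrow> n \<ge> 1 \<Longrightarrow>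
    real n * ((\<integral>x. \<phi> x \<partial>M) + entropy_rate - \<theta>) - ln 2 \<le> ln (S_hat T n \<phi> M \<epsilon>)"
proof -
  obtain B where B: "\<And>x. \<bar>\<phi> x\<bar> \<le> B" using continuous_bounded[OF \<phi>] by blast
  have "B \<ge> 0" using B[of undefined] by linarith
  define m where "m = num_labels"
  have m: "m \<ge> 1" using num_labels_ge_1 by (simp add: m_def)
  define \<eta> where "\<eta> = 1 - exp (- (\<theta> / 4))"
  have \<eta>: "0 < \<eta>" "\<eta> < 1" "ln (1 - \<eta>) = - (\<theta> / 4)" using \<theta> by (auto simp: \<eta>_def)
  define \<Lambda> where "\<Lambda> = ln (m / \<eta>)"
  have "\<Lambda> \<ge> 0"
    unfolding \<Lambda>_def using m \<eta> by (intro ln_ge_zero) (simp add: pos_le_divide_eq)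
  \<comment> \<open>The order of choices matters: \<eta> fixes \<Lambda>, which fixes the allowed
    measure of - K, which fixes r, which fixes the bound on \<epsilon>. The added 1 keeps the
    denominator positive.\<close>
  have "\<theta> / (4 * (\<Lambda> + 1)) > 0" using \<theta> \<open>\<Lambda> \<ge> 0\<close> by simp
  from coarse_label_exists[OF this] obtain K r1 and \<beta> :: "'a \<Rightarrow> 'b"
    where K: "K \<in> sets M" "prob (- K) \<le> \<theta> / (4 * (\<Lambda> + 1))" and r1: "r1 > 0"
      and \<beta>: "\<And>x y. y \<in> K \<Longrightarrow> dist x y < r1 \<Longrightarrow> \<beta> x = l y" by blast
  have "uniformly_continuous_on UNIV \<phi>"
    by (rule compact_uniformly_continuous[OF \<phi> compact_UNIV])
  then obtain r2 where r2: "r2 > 0" "\<And>x y. dist x y < r2 \<Longrightarrow> dist (\<phi> x) (\<phi> y) < \<theta> / 4"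
    unfolding uniformly_continuous_on_def using \<theta> by (metis UNIV_I divide_pos_pos zero_less_numeral)
  define r where "r = min r1 r2"
  have "r > 0" using r1 r2 by (simp add: r_def)
  \<comment> \<open>The coefficient of \<epsilon>: the far times, then the complement of the covered
    set, whose measure is at most \<epsilon>. The final 1 makes A at least 1.\<close>
  define A where "A = (2 * B + \<Lambda>) / r + (2 * B + ln m) + 1"
  have "A \<ge> 1" using \<open>B \<ge> 0\<close> \<open>\<Lambda> \<ge> 0\<close> \<open>r > 0\<close> m by (simp add: A_def)
  have K_cost: "prob (- K) * \<Lambda> \<le> \<theta> / 4"
  proof -
    have "prob (- K) * \<Lambda> \<le> \<theta> / (4 * (\<Lambda> + 1)) * (\<Lambda> + 1)"
      using K \<open>\<Lambda> \<ge> 0\<close> \<theta> by (intro mult_mono) auto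
    also have "\<dots> = \<theta> / 4" using \<open>\<Lambda> \<ge> 0\<close> by (simp add: field_simps)
    finally show ?thesis .
  qed
  define \<epsilon>0 where "\<epsilon>0 = min 1 (\<theta> / (4 * A))"
  have "\<epsilon>0 > 0" using \<theta> \<open>A \<ge> 1\<close> by (simp add: \<epsilon>0_def)
  moreover have "real n * ((\<integral>x. \<phi> x \<partial>M) + entropy_rate - \<theta>) - ln 2 \<le> ln (S_hat T n \<phi> M \<epsilon>)"
    if \<epsilon>: "0 < \<epsilon>" "\<epsilon> < \<epsilon>0" and n: "n \<ge> 1" for \<epsilon> n
  proof -
    define c where "c = real n * ((\<integral>x. \<phi> x \<partial>M) + entropy_rate - \<theta>) - ln 2"
    have \<epsilon>_cost: "\<epsilon> * A \<le> \<theta> / 4"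
    proof -
      have "\<epsilon> * A \<le> \<theta> / (4 * A) * A"
        using \<epsilon> \<open>A \<ge> 1\<close> by (intro mult_right_mono) (auto simp: \<epsilon>0_def)
      then show ?thesis using \<open>A \<ge> 1\<close> by simp
    qed
    have "exp c \<le> S_hat T n \<phi> M \<epsilon>"
    proof (rule S_hat_lower_bound[OF compact_UNIV T_continuous n \<epsilon>(1) prob_space_axioms _ space_eq])
      fix q k :: nat and x :: "nat \<Rightarrow> 'a"
      let ?G = "\<Union>i\<in>{1..k}. max_mean_ball T q n (x i) \<epsilon>" and ?I = "(*) q ` {..<n}"
      assume "q \<ge> 1" "k \<ge> 1" and G: "1 - \<epsilon> < prob ?G"
      have inj: "inj_on ((*) q) {..<n}" using \<open>q \<ge> 1\<close> by (auto simp: inj_on_def)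
      then have card: "card ?I = n" by (simp add: card_image)
      have G_sets: "?G \<in> sets M"
        unfolding sets_eq using open_max_mean_ball[OF T_continuous n] by (intro sets.finite_UN) auto
      have G_small: "prob (- ?G) \<le> \<epsilon>"
        using G prob_compl[OF G_sets] by (simp add: Compl_eq_Diff_UNIV)
      define Z where "Z = (\<Sum>c\<in>{1..k}. exp (\<Sum>i\<in>?I. \<phi> ((T ^^ i) (x c))))"
      have Z: "Z = (\<Sum>i=1..k. exp (orbit_sum T q n \<phi> (x i)))"
        unfolding Z_def orbit_sum_def by (simp add: sum.reindex[OF inj])
      have "Z > 0" unfolding Z_def using \<open>k \<ge> 1\<close> by (intro sum_pos) auto
      have "\<H>(name ?I) \<le> ln Z + ln 2 + real (card ?I) *
        (- (\<integral>x. \<phi> x \<partial>M) + \<theta> / 4 - ln (1 - \<eta>) + \<epsilon> * ((2 * B + ln (num_labels / \<eta>)) / r)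
          + prob (- K) * ln (num_labels / \<eta>) + prob (- ?G) * (2 * B + ln num_labels))"
        unfolding Z_def
      proof (rule entropy_name_le_cover_sum[where D = "\<lambda>c y i. dist ((T ^^ i) (x c)) ((T ^^ i) y)"
            and \<beta> = \<beta> and \<gamma> = "\<theta> / 4"])
        show "\<beta> ((T ^^ i) (x c)) = l ((T ^^ i) y)"
          if "dist ((T ^^ i) (x c)) ((T ^^ i) y) < r" "(T ^^ i) y \<in> K" for c y i
          using that by (intro \<beta>) (auto simp: r_def)
        show "\<bar>\<phi> ((T ^^ i) (x c)) - \<phi> ((T ^^ i) y)\<bar> \<le> \<theta> / 4"
          if "dist ((T ^^ i) (x c)) ((T ^^ i) y) < r" for c y i
          using r2(2)[of "(T ^^ i) (x c)" "(T ^^ i) y"] that by (simp add: r_def dist_real_def)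
        show "\<exists>c\<in>{1..k}. (\<Sum>i\<in>?I. dist ((T ^^ i) (x c)) ((T ^^ i) y)) \<le> real (card ?I) * \<epsilon>"
          if y: "y \<in> ?G" for y
        proof -
          obtain c where c: "c \<in> {1..k}" "y \<in> max_mean_ball T q n (x c) \<epsilon>" using y by (rule UN_E)
          then have "mean_dist T q n (x c) y < \<epsilon>"
            using n by (auto simp: max_mean_ball_def max_mean_dist_less_iff)
          then have "(\<Sum>i<n. dist ((T ^^ (q * i)) (x c)) ((T ^^ (q * i)) y)) < \<epsilon> * real n"
            using n by (simp add: mean_dist_def pos_divide_less_eq)
          then have "(\<Sum>i\<in>?I. dist ((T ^^ i) (x c)) ((T ^^ i) y)) \<le> real (card ?I) * \<epsilon>"
            unfolding card by (simp add: sum.reindex[OF inj] mult.commute[of "real n"])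
          with c(1) show ?thesis by (rule bexI[rotated])
        qed
      qed (use \<eta> \<theta> \<epsilon> \<open>r > 0\<close> B K G_sets \<open>k \<ge> 1\<close> continuous_borel_measurable[OF \<phi>] in auto)
      also have "\<dots> \<le> ln Z + ln 2 + real n * (- (\<integral>x. \<phi> x \<partial>M) + \<theta>)"
      proof -
        have "prob (- ?G) * (2 * B + ln m) \<le> \<epsilon> * (2 * B + ln m)"
          using G_small \<open>B \<ge> 0\<close> m by (intro mult_right_mono) auto
        moreover have "\<epsilon> * A = \<epsilon> * ((2 * B + \<Lambda>) / r) + \<epsilon> * (2 * B + ln m) + \<epsilon>"
          unfolding A_def by (simp only: distrib_left mult_1_right)
        ultimately have "\<epsilon> * ((2 * B + \<Lambda>) / r) + prob (- ?G) * (2 * B + ln m) \<le> \<theta> / 4"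
          using \<epsilon>_cost \<epsilon>(1) by linarith
        then have "- (\<integral>x. \<phi> x \<partial>M) + \<theta> / 4 - ln (1 - \<eta>) + \<epsilon> * ((2 * B + \<Lambda>) / r)
          + prob (- K) * \<Lambda> + prob (- ?G) * (2 * B + ln m) \<le> - (\<integral>x. \<phi> x \<partial>M) + \<theta>"
          using K_cost \<eta>(3) by linarith
        then show ?thesis
          unfolding card \<Lambda>_def m_def by (intro add_left_mono mult_left_mono) auto
      qed
      finally have "real n * entropy_rate \<le> ln Z + ln 2 + real n * (- (\<integral>x. \<phi> x \<partial>M) + \<theta>)"
        using entropy_rate_le_progression[OF \<open>q \<ge> 1\<close>, of n] by linarith
      then have "c \<le> ln Z" by (simp add: c_def algebra_simps)
      then have "exp c \<le> Z" using \<open>Z > 0\<close> by (metis exp_le_cancel_iff exp_ln)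
      then show "exp c \<le> (\<Sum>i=1..k. exp (orbit_sum T q n \<phi> (x i)))" by (simp only: Z)
    qed
    then have "ln (exp c) \<le> ln (S_hat T n \<phi> M \<epsilon>)"
      by (subst ln_le_cancel_iff) (auto intro: less_le_trans[OF exp_gt_zero])
    then show ?thesis by (simp add: c_def)
  qed
  ultimately show thesis by (rule that)
qed

end

section \<open>The upper bound\<close>

text \<open>The weights of all words of length s add up to at most 1, so at most exp t words can
  have weight exp (- t) or more.\<close>

lemma card_block_codes_le:
  fixes p :: "'c \<Rightarrow> real" and s :: nat
  assumes "finite F" and p: "\<And>b. b \<in> F \<Longrightarrow> 0 \<le> p b" "(\<Sum>b\<in>F. p b) \<le> 1"
  shows "real (card {b \<in> {..<s} \<rightarrow>\<^sub>E F. exp (- t) \<le> (\<Prod>i<s. p (b i))}) \<le> exp t"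
proof -
  let ?Q = "{b \<in> {..<s} \<rightarrow>\<^sub>E F. exp (- t) \<le> (\<Prod>i<s. p (b i))}"
  have fin: "finite ({..<s::nat} \<rightarrow>\<^sub>E F)" using assms(1) by (intro finite_PiE) auto
  have "real (card ?Q) * exp (- t) = (\<Sum>b\<in>?Q. exp (- t))" by simp
  also have "\<dots> \<le> (\<Sum>b\<in>?Q. \<Prod>i<s. p (b i))" by (intro sum_mono) simp
  also have "\<dots> \<le> (\<Sum>b\<in>{..<s} \<rightarrow>\<^sub>E F. \<Prod>i<s. p (b i))"
  proof (rule sum_mono2[OF fin])
    show "0 \<le> (\<Prod>i<s. p (b i))" if "b \<in> ({..<s} \<rightarrow>\<^sub>E F) - ?Q" for b
    proof (rule prod_nonneg)
      fix i assume "i \<in> {..<s}"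
      with that have "b i \<in> F" by (intro PiE_mem[of b "{..<s}" "\<lambda>_. F"]) simp_all
      then show "0 \<le> p (b i)" by (rule p(1))
    qed
  qed (rule Collect_restrict)
  also have "\<dots> = (\<Prod>i<s. \<Sum>b\<in>F. p b)"
    using assms(1) by (intro prod_sum_PiE[symmetric]) auto
  also have "\<dots> \<le> 1"
    using p by (intro prod_le_1 conjI sum_nonneg) auto
  finally show ?thesis by (simp add: exp_minus field_simps)
qed

context labelled_system
begin

lemma finite_name_image: "finite I \<Longrightarrow> finite (name I ` G)"
  by (rule finite_subset[OF image_mono[OF subset_UNIV] simple_range_finite[OF name_simple]])

text \<open>Times before j are read off the first k letters, since j < k. A time i \<ge> j lies in
  block (i - j) div k, which is one of the s blocks because i - j < k * s.\<close>

lemma name_determined_by_blocks: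
  assumes "k \<ge> 1" "n \<le> k * s" and head: "name {..<k} x = name {..<k} y" and "j < k"
    and blocks: "\<And>i. i < s \<Longrightarrow>
      name {..<k} ((T ^^ (j + k * i)) x) = name {..<k} ((T ^^ (j + k * i)) y)"
  shows "name {..<n} x = name {..<n} y"
  unfolding name_eq_iff
proof
  fix i assume "i \<in> {..<n}"
  show "l ((T ^^ i) x) = l ((T ^^ i) y)"
  proof (cases "i < j")
    case True
    then have "i \<in> {..<k}" using \<open>j < k\<close> by simp
    then show ?thesis using head unfolding name_eq_iff by (rule bspec[rotated])
  next
    case False
    define u where "u = (i - j) div k"
    define v where "v = (i - j) mod k"
    have "i - j < k * s" using \<open>i \<in> {..<n}\<close> assms(2) by simp
    then have "u < s" unfolding u_def by (simp add: less_mult_imp_div_less mult.commute)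
    have "v \<in> {..<k}" using assms(1) by (simp add: v_def)
    then have "l ((T ^^ v) ((T ^^ (j + k * u)) x)) = l ((T ^^ v) ((T ^^ (j + k * u)) y))"
      using blocks[OF \<open>u < s\<close>] unfolding name_eq_iff by (rule bspec[rotated])
    moreover have "v + (j + k * u) = i"
      using False mod_mult_div_eq[of "i - j" k] unfolding u_def v_def by linarith
    ultimately show ?thesis
      using funpow_add[of v "j + k * u" T] by (simp only: comp_apply)
  qed
qed

lemma sum_residue_classes:
  fixes g :: "nat \<Rightarrow> real"
  shows "(\<Sum>i<k * s. g i) = (\<Sum>j<k. \<Sum>i<s. g (j + k * i))"
proof -
  have "(\<Sum>i<k * s. g i) = (\<Sum>i<s. \<Sum>j\<in>{i * k..<i * k + k}. g j)"
    by (simp add: sum.nat_group mult.commute)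
  also have "\<dots> = (\<Sum>i<s. \<Sum>j<k. g (j + k * i))"
    by (simp add: sum.atLeastLessThan_shift_0[of g] lessThan_atLeast0 add.commute mult.commute)
  also have "\<dots> = (\<Sum>j<k. \<Sum>i<s. g (j + k * i))" by (rule sum.swap)
  finally show ?thesis .
qed

(* Some residue class j mod k has at most average information content, so a name is determined by j,
   its first k letters and a sequence of s blocks of probability at least exp (- s c). *)
lemma card_names_le:
  fixes c :: real and k :: nat
  defines "p \<equiv> \<lambda>b. prob (name {..<k} -` {b})"
  assumes "k \<ge> 1" "n \<le> k * s"
    and sum: "\<And>x. x \<in> G \<Longrightarrow> orbit_sum T 1 (k * s) (\<lambda>x. - ln (p (name {..<k} x))) x \<le> real (k * s) * c"
    and pos: "\<And>x i. x \<in> G \<Longrightarrow> 0 < p (name {..<k} ((T ^^ i) x))"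
  shows "real (card (name {..<n} ` G)) \<le> real k * real (card (range (name {..<k}))) * exp (real s * c)"
proof -
  let ?X = "name {..<k}"
  let ?F = "range ?X"
  have X: "simple_function M ?X" by (intro name_simple) simp
  have fin: "finite ?F" by (rule simple_range_finite[OF X])
  define Q where "Q = {b \<in> {..<s} \<rightarrow>\<^sub>E ?F. exp (- (real s * c)) \<le> (\<Prod>i<s. p (b i))}"
  have "(\<Sum>b\<in>?F. p b) = 1"
    using integral_simple_compose(2)[OF X, of "\<lambda>_. 1"] by (simp add: p_def)
  then have Q_card: "real (card Q) \<le> exp (real s * c)"
    unfolding Q_def using fin by (intro card_block_codes_le) (auto simp: p_def)
  have "finite Q"
    unfolding Q_def using fin by (intro finite_subset[OF _ finite_PiE[of "{..<s}" "\<lambda>_. ?F"]]) auto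
  define code where "code = (\<lambda>j x. \<lambda>i\<in>{..<s}. ?X ((T ^^ (j + k * i)) x))"
  have "\<exists>j<k. code j x \<in> Q" if "x \<in> G" for x
  proof -
    define g where "g = (\<lambda>i. - ln (p (?X ((T ^^ i) x))))"
    have total: "(\<Sum>j<k. \<Sum>i<s. g (j + k * i)) \<le> real k * (real s * c)"
      using sum[OF that] sum_residue_classes[of g k s] by (simp add: orbit_sum_def g_def)
    have "\<exists>j<k. (\<Sum>i<s. g (j + k * i)) \<le> real s * c"
    proof (rule ccontr)
      assume "\<not> (\<exists>j<k. (\<Sum>i<s. g (j + k * i)) \<le> real s * c)"
      then have "(\<Sum>j<k. real s * c) < (\<Sum>j<k. \<Sum>i<s. g (j + k * i))"
        using assms(2) by (intro sum_strict_mono) (auto simp: lessThan_empty_iff not_le)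
      then show False using total by simp
    qed
    then obtain j where j: "j < k" "(\<Sum>i<s. g (j + k * i)) \<le> real s * c" by blast
    have "exp (- (real s * c)) \<le> exp (\<Sum>i<s. - g (j + k * i))"
      using j(2) by (simp add: sum_negf)
    \<comment> \<open>Here positivity enters: since \<open>ln 0 = 0\<close>, a null block would
      count as carrying no information.\<close>
    also have "\<dots> = (\<Prod>i<s. p (?X ((T ^^ (j + k * i)) x)))"
      using pos[OF that] by (simp add: exp_sum g_def)
    finally have "code j x \<in> Q" by (simp add: Q_def code_def)
    then show ?thesis using j(1) by blast
  qed
  then obtain J where J: "\<And>x. x \<in> G \<Longrightarrow> J x < k" "\<And>x. x \<in> G \<Longrightarrow> code (J x) x \<in> Q"
    by metis
  define rep where "rep = inv_into G (name {..<n})"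
  have rep: "rep b \<in> G" "name {..<n} (rep b) = b" if "b \<in> name {..<n} ` G" for b
    unfolding rep_def using that by (rule inv_into_into, rule f_inv_into_f)
  define enc where "enc = (\<lambda>b. (J (rep b), ?X (rep b), code (J (rep b)) (rep b)))"
  have "inj_on enc (name {..<n} ` G)"
  proof (rule inj_onI)
    fix b b' assume b: "b \<in> name {..<n} ` G" "b' \<in> name {..<n} ` G" and "enc b = enc b'"
    from this(3) have "J (rep b) = J (rep b') \<and> ?X (rep b) = ?X (rep b') \<and>
        code (J (rep b)) (rep b) = code (J (rep b')) (rep b')"
      unfolding enc_def prod.inject .
    note enc = conjunct1[OF this] conjunct1[OF conjunct2[OF this]] conjunct2[OF conjunct2[OF this]]
    from enc(3) have eq: "code (J (rep b)) (rep b) = code (J (rep b)) (rep b')"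
      unfolding enc(1) by simp
    have "name {..<n} (rep b) = name {..<n} (rep b')"
    proof (rule name_determined_by_blocks[OF assms(2,3) enc(2)])
      show "J (rep b) < k" by (rule J(1)[OF rep(1)[OF b(1)]])
      show "?X ((T ^^ (J (rep b) + k * i)) (rep b)) = ?X ((T ^^ (J (rep b) + k * i)) (rep b'))"
        if "i < s" for i
        using fun_cong[OF eq, of i] that by (simp add: code_def)
    qed
    then show "b = b'" by (simp only: rep(2)[OF b(1)] rep(2)[OF b(2)])
  qed
  moreover have "enc ` (name {..<n} ` G) \<subseteq> {..<k} \<times> ?F \<times> Q"
  proof (rule image_subsetI)
    fix b assume "b \<in> name {..<n} ` G"
    then have "rep b \<in> G" by (rule rep(1))
    then show "enc b \<in> {..<k} \<times> ?F \<times> Q" using J by (simp add: enc_def)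
  qed
  ultimately have "card (name {..<n} ` G) \<le> card ({..<k} \<times> ?F \<times> Q)"
    using fin \<open>finite Q\<close> by (intro card_inj_on_le) auto
  then have "real (card (name {..<n} ` G)) \<le> real k * (real (card ?F) * real (card Q))"
    by (simp add: card_cartesian_product flip: of_nat_mult)
  also have "\<dots> \<le> real k * (real (card ?F) * exp (real s * c))"
    using Q_card by (intro mult_left_mono) auto
  finally show ?thesis by (simp add: mult.assoc)
qed

text \<open>There are finitely many names, so those of probability 0 together fill a null set, and
  the union of its countably many preimages is still null.\<close>

lemma AE_name_prob_pos:
  assumes "finite I"
  shows "AE x in M. \<forall>i. 0 < prob (name I -` {name I ((T ^^ i) x)})"
proof -
  let ?p = "\<lambda>b. prob (name I -` {b})"
  have X: "simple_function M (name I)" by (rule name_simple[OF assms])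
  let ?z = "\<lambda>b. if ?p b = 0 then 1 else 0 :: real"
  have "(\<integral>x. ?z (name I x) \<partial>M) = 0"
    unfolding integral_simple_compose(2)[OF X, of ?z] by (intro sum.neutral) auto
  then have "AE x in M. ?z (name I x) = 0"
    using integral_simple_compose(1)[OF X, of ?z] by (subst (asm) integral_nonneg_eq_0_iff_AE) auto
  then have "AE x in M. 0 < ?p (name I x)"
    by eventually_elim (auto simp: less_le split: if_splits)
  moreover have "{x. 0 < ?p (name I x)} \<in> sets M"
    using simple_vimage_sets[OF X, of "{b. 0 < ?p b}"] by (simp add: vimage_def)
  ultimately have "AE x in M. 0 < ?p (name I ((T ^^ i) x))" for i
    by (rule AE_T_pow)
  then show ?thesis by (simp add: AE_all_countable)
qed

end

section \<open>The upper bound for a labelling with small cells\<close>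

context borel_system
begin

text \<open>A single centre already contributes at least exp (- n B). Positivity is what allows
  inequalities for \<open>S_hat\<close> to pass to logarithms.\<close>

lemma S_hat_pos:
  assumes \<phi>: "continuous_on UNIV (\<phi> :: 'a \<Rightarrow> real)" and "n \<ge> 1" "\<epsilon> > 0"
  shows "0 < S_hat T n \<phi> M \<epsilon>"
proof -
  obtain B where B: "\<And>x. \<bar>\<phi> x\<bar> \<le> B" using continuous_bounded[OF \<phi>] by blast
  have "exp (- (real n * B)) \<le> S_hat T n \<phi> M \<epsilon>"
  proof (rule S_hat_lower_bound[OF compact_UNIV T_continuous assms(2,3) prob_space_axioms _ space_eq])
    fix q k :: nat and x :: "nat \<Rightarrow> 'a"
    assume "k \<ge> 1"
    have "(\<Sum>i<n. - B) \<le> orbit_sum T q n \<phi> (x 1)"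
      unfolding orbit_sum_def using B by (intro sum_mono) (simp add: abs_le_iff minus_le_iff)
    then have "exp (- (real n * B)) \<le> exp (orbit_sum T q n \<phi> (x 1))" by simp
    also have "\<dots> \<le> (\<Sum>i=1..k. exp (orbit_sum T q n \<phi> (x i)))"
      using \<open>k \<ge> 1\<close> by (intro member_le_sum) auto
    finally show "exp (- (real n * B)) \<le> (\<Sum>i=1..k. exp (orbit_sum T q n \<phi> (x i)))" .
  qed
  then show ?thesis by (rule less_le_trans[OF exp_gt_zero])
qed

text \<open>One representative per name serves as a centre; it is taken in G so that its orbit sum
  obeys the bound b. The balls cover G because equal names mean distance below \<epsilon> at every
  time.\<close>

lemma S_hat_le_card_names:
  assumes "n \<ge> 1" and diam: "\<And>x y. l x = l y \<Longrightarrow> dist x y < \<epsilon>"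
    and G: "G \<in> sets M" "1 - \<epsilon> < prob G" "\<epsilon> < 1"
    and \<phi>: "\<And>x. x \<in> G \<Longrightarrow> orbit_sum T 1 n \<phi> x \<le> b"
  shows "S_hat T n \<phi> M \<epsilon> \<le> real (card (name {..<n} ` G)) * exp b"
    and "name {..<n} ` G \<noteq> {}"
proof -
  let ?N = "name {..<n} ` G"
  have "finite ?N" by (rule finite_name_image) simp
  have "G \<noteq> {}" using G by auto
  then show "?N \<noteq> {}" by simp
  then have card: "card ?N \<ge> 1" using \<open>finite ?N\<close> by (simp add: Suc_le_eq card_gt_0_iff)
  obtain e where e: "bij_betw e {1..card ?N} ?N"
    using ex_bij_betw_nat_finite_1[OF \<open>finite ?N\<close>] by blast
  define x where "x = (\<lambda>i. inv_into G (name {..<n}) (e i))"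
  have e_in: "e i \<in> ?N" if "i \<in> {1..card ?N}" for i
    using bij_betwE[OF e] that by blast
  have x: "x i \<in> G" "name {..<n} (x i) = e i" if "i \<in> {1..card ?N}" for i
    unfolding x_def using e_in[OF that] by (rule inv_into_into, rule f_inv_into_f)
  let ?U = "\<Union>i\<in>{1..card ?N}. max_mean_ball T 1 n (x i) \<epsilon>"
  have "G \<subseteq> ?U"
  proof
    fix y assume "y \<in> G"
    then have "name {..<n} y \<in> e ` {1..card ?N}" using bij_betw_imp_surj_on[OF e] by simp
    then obtain i where i: "i \<in> {1..card ?N}" "name {..<n} y = e i" by auto
    then have "name {..<n} (x i) = name {..<n} y" using x(2)[OF i(1)] by simp
    then have eq: "\<forall>j\<in>{..<n}. l ((T ^^ j) (x i)) = l ((T ^^ j) y)" by (simp only: name_eq_iff)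
    have "y \<in> max_mean_ball T 1 n (x i) \<epsilon>"
    proof (rule max_mean_ballI[OF assms(1)])
      fix j assume "j < n"
      then have "l ((T ^^ j) (x i)) = l ((T ^^ j) y)" using eq by simp
      from diam[OF this] show "dist ((T ^^ (1 * j)) (x i)) ((T ^^ (1 * j)) y) < \<epsilon>" by simp
    qed
    then show "y \<in> ?U" using i(1) by (rule UN_I[rotated])
  qed
  moreover have "?U \<in> sets M"
    unfolding sets_eq using open_max_mean_ball[OF T_continuous assms(1)] by (intro sets.finite_UN) auto
  ultimately have "1 - \<epsilon> < prob ?U"
    using G(2) finite_measure_mono[of G ?U] by linarith
  then have "S_hat T n \<phi> M \<epsilon> \<le> (\<Sum>i=1..card ?N. exp (orbit_sum T 1 n \<phi> (x i)))"
    using card by (intro S_hat_le) auto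
  also have "\<dots> \<le> (\<Sum>i=1..card ?N. exp b)"
    using x(1) \<phi> by (intro sum_mono) simp
  finally show "S_hat T n \<phi> M \<epsilon> \<le> real (card ?N) * exp b" by simp
qed

lemma ln_S_hat_upper:
  fixes \<phi> :: "'a \<Rightarrow> real"
  assumes ergodic: "\<And>A. A \<in> sets M \<Longrightarrow> T -` A = A \<Longrightarrow> prob A = 0 \<or> prob A = 1"
    and \<phi>: "continuous_on UNIV \<phi>" and diam: "\<And>x y. l x = l y \<Longrightarrow> dist x y < \<epsilon>"
    and \<epsilon>: "0 < \<epsilon>" "\<epsilon> < 1" and "\<theta> > 0"
  shows "\<forall>\<^sub>F n in sequentially.
    ln (S_hat T n \<phi> M \<epsilon>) \<le> real n * ((\<integral>x. \<phi> x \<partial>M) + entropy_rate + \<theta>)"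
proof -
  \<comment> \<open>Four losses of \<tau> per unit of time: from the entropy rate to H_k / k, from h
    to c, from the integral of \<phi> to d, and for the constant C.\<close>
  define \<tau> where "\<tau> = \<theta> / 4"
  have "\<tau> > 0" using \<open>\<theta> > 0\<close> by (simp add: \<tau>_def)
  have "\<forall>\<^sub>F n in sequentially. \<H>(name {..<n}) / real n < entropy_rate + \<tau>"
    using \<open>\<tau> > 0\<close> by (intro order_tendstoD(2)[OF entropy_rate_lim]) simp
  then have "\<forall>\<^sub>F n in sequentially. 1 \<le> n \<and> \<H>(name {..<n}) / real n < entropy_rate + \<tau>"
    by (rule eventually_conj[OF eventually_ge_at_top])
  then obtain k where k: "1 \<le> k" "\<H>(name {..<k}) / real k < entropy_rate + \<tau>"
    using eventually_happens'[OF sequentially_bot] by blast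
  let ?X = "name {..<k}"
  define h where "h = \<H>(?X)"
  have X: "simple_function M ?X" by (intro name_simple) simp
  define p where "p = (\<lambda>b. prob (?X -` {b}))"
  define f where "f = (\<lambda>x. - ln (p (?X x)))"
  have f: "integrable M f" "(\<integral>x. f x \<partial>M) = h"
    unfolding f_def h_def p_def
    using integral_simple_compose(1)[OF X, of "\<lambda>b. - ln (prob (?X -` {b}))"]
    by (simp_all add: entropy_simple_eq_integral[OF X])
  define c where "c = h + real k * \<tau>"
  have "h < c" using k \<open>\<tau> > 0\<close> by (simp add: c_def)
  define d where "d = (\<integral>x. \<phi> x \<partial>M) + \<tau>"
  obtain B where B: "\<And>x. \<bar>\<phi> x\<bar> \<le> B" using continuous_bounded[OF \<phi>] by blast
  have \<phi>_meas [measurable]: "\<phi> \<in> borel_measurable M" by (rule continuous_borel_measurable[OF \<phi>])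
  have f_meas [measurable]: "f \<in> borel_measurable M" using f(1) by auto
  have "integrable M \<phi>" using B by (intro integrable_const_bound[where B=B]) auto
  then have lim_\<phi>: "(\<lambda>n. prob {x. orbit_sum T 1 n \<phi> x > real n * d}) \<longlonglongrightarrow> 0"
    using \<open>\<tau> > 0\<close> by (intro ergodic_orbit_sum_upper ergodic) (simp_all add: d_def)
  have lim_f: "(\<lambda>n. prob {x. orbit_sum T 1 n f x > real n * c}) \<longlonglongrightarrow> 0"
    using f \<open>h < c\<close> by (intro ergodic_orbit_sum_upper ergodic) simp_all
  \<comment> \<open>One block more than n div k, so that the blocks cover n letters. The surplus
    block costs c, which enters the constant C.\<close>
  define s where "s = (\<lambda>n. n div k + 1)"
  have s: "n \<le> k * s n" for n
  proof -
    have "k * (n div k) + n mod k = n" "k * s n = k * (n div k) + k" by (simp_all add: s_def)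
    moreover have "n mod k < k" using k(1) by simp
    ultimately show ?thesis by linarith
  qed
  have "filterlim (\<lambda>n. k * s n) sequentially sequentially"
    using s by (intro filterlim_at_top_mono[OF filterlim_ident]) auto
  from filterlim_compose[OF lim_f this]
  have lim_f': "(\<lambda>n. prob {x. orbit_sum T 1 (k * s n) f x > real (k * s n) * c}) \<longlonglongrightarrow> 0" .
  define C where "C = ln (real k) + ln (real (card (range ?X))) + c"
  have "(\<lambda>n. C / real n) \<longlonglongrightarrow> 0" by (rule lim_const_over_n)
  then have "\<forall>\<^sub>F n in sequentially. C / real n < \<tau>"
    using \<open>\<tau> > 0\<close> by (intro order_tendstoD(2))
  moreover have "\<forall>\<^sub>F n in sequentially. prob {x. orbit_sum T 1 n \<phi> x > real n * d} < \<epsilon> / 3"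
    using \<epsilon> by (intro order_tendstoD(2)[OF lim_\<phi>]) simp
  moreover have "\<forall>\<^sub>F n in sequentially.
      prob {x. orbit_sum T 1 (k * s n) f x > real (k * s n) * c} < \<epsilon> / 3"
    using \<epsilon> by (intro order_tendstoD(2)[OF lim_f']) simp
  ultimately show ?thesis
    using eventually_ge_at_top[of 1]
  proof eventually_elim
    case (elim n)
    then have n: "n \<ge> 1" by simp
    let ?B1 = "{x. orbit_sum T 1 n \<phi> x > real n * d}"
    let ?B2 = "{x. orbit_sum T 1 (k * s n) f x > real (k * s n) * c}"
    have "{x \<in> space M. orbit_sum T 1 n \<phi> x > real n * d} \<in> sets M"
      "{x \<in> space M. orbit_sum T 1 (k * s n) f x > real (k * s n) * c} \<in> sets M"
      by measurable
    then have B_sets: "?B1 \<in> sets M" "?B2 \<in> sets M" by simp_all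
    have "AE x in M. \<forall>i. 0 < p (?X ((T ^^ i) x))"
      unfolding p_def by (rule AE_name_prob_pos) simp
    then obtain N where "{x \<in> space M. \<not> (\<forall>i. 0 < p (?X ((T ^^ i) x)))} \<subseteq> N"
        "emeasure M N = 0" "N \<in> sets M"
      by (rule AE_E)
    then have N: "N \<in> sets M" "prob N = 0" "{x. \<not> (\<forall>i. 0 < p (?X ((T ^^ i) x)))} \<subseteq> N"
      by (simp_all add: measure_def)
    \<comment> \<open>The two sets of large sums have measure below \<epsilon> / 3 each, and N,
      which contains every point that ever meets a null block, has measure 0.\<close>
    define G where "G = - (?B1 \<union> ?B2 \<union> N)"
    have "?B1 \<union> ?B2 \<union> N \<in> sets M" using B_sets N(1) by (intro sets.Un)
    moreover from this have "prob G = 1 - prob (?B1 \<union> ?B2 \<union> N)"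
      using prob_compl[of "?B1 \<union> ?B2 \<union> N"] by (simp only: G_def Compl_eq_Diff_UNIV space_eq)
    moreover have "prob (?B1 \<union> ?B2 \<union> N) \<le> prob ?B1 + prob ?B2 + prob N"
      using measure_Un_le[OF sets.Un[OF B_sets] N(1)] measure_Un_le[OF B_sets] by linarith
    ultimately have G: "G \<in> sets M" "1 - \<epsilon> < prob G"
      using elim(2,3) N(2) \<epsilon>(1) sets.compl_sets[of "?B1 \<union> ?B2 \<union> N" M]
      by (simp_all only: G_def Compl_eq_Diff_UNIV space_eq)
    have G_mem: "orbit_sum T 1 n \<phi> x \<le> real n * d" "orbit_sum T 1 (k * s n) f x \<le> real (k * s n) * c"
      if "x \<in> G" for x
      using that by (simp_all add: G_def not_less)
    have p_pos: "0 < p (?X ((T ^^ i) x))" if "x \<in> G" for x i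
    proof -
      have "x \<notin> {x. \<not> (\<forall>i. 0 < p (?X ((T ^^ i) x)))}"
        using that N(3) by (auto simp: G_def)
      then show ?thesis by simp
    qed
    let ?K = "real (card (name {..<n} ` G))"
    have le: "S_hat T n \<phi> M \<epsilon> \<le> ?K * exp (real n * d)" and ne: "name {..<n} ` G \<noteq> {}"
      using S_hat_le_card_names[OF n diam G \<epsilon>(2) G_mem(1)] by blast+
    have "?K > 0"
      using ne finite_name_image[of "{..<n}" G] by (simp add: card_gt_0_iff)
    have "?K \<le> real k * real (card (range ?X)) * exp (real (s n) * c)"
      using G_mem(2) p_pos unfolding f_def p_def by (intro card_names_le k s)
    then have "ln ?K \<le> ln (real k * real (card (range ?X)) * exp (real (s n) * c))"
      using \<open>?K > 0\<close> by (subst ln_le_cancel_iff) auto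
    also have "\<dots> = ln (real k) + ln (real (card (range ?X))) + real (s n) * c"
      using k(1) simple_range_finite[OF X] by (simp add: ln_mult card_gt_0_iff)
    finally have ln_K: "ln ?K \<le> ln (real k) + ln (real (card (range ?X))) + real (s n) * c" .
    have "ln (S_hat T n \<phi> M \<epsilon>) \<le> ln (?K * exp (real n * d))"
      using le S_hat_pos[OF \<phi> n \<epsilon>(1)] by (subst ln_le_cancel_iff) auto
    also have "\<dots> = ln ?K + real n * d" using \<open>?K > 0\<close> by (simp add: ln_mult)
    finally have main: "ln (S_hat T n \<phi> M \<epsilon>) \<le>
        ln (real k) + ln (real (card (range ?X))) + real (s n) * c + real n * d"
      using ln_K by linarith
    have "c \<le> real k * (entropy_rate + 2 * \<tau>)"
    proof -
      have "h < real k * (entropy_rate + \<tau>)"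
        using k by (simp add: h_def pos_divide_less_eq mult.commute)
      then show ?thesis by (simp add: c_def algebra_simps)
    qed
    have "real (s n) * c \<le> real n * (entropy_rate + 2 * \<tau>) + c"
    proof -
      \<comment> \<open>Replacing the rounded quotient by n / k requires c \<ge> 0, which follows
        from 0 \<le> h < c.\<close>
      have "real (n div k) * c \<le> real n / real k * c"
        using entropy_simple_nonneg[OF X] \<open>h < c\<close>
        by (intro mult_right_mono of_nat_div_le_of_nat) (simp add: h_def)
      also have "\<dots> \<le> real n / real k * (real k * (entropy_rate + 2 * \<tau>))"
        using \<open>c \<le> _\<close> by (intro mult_left_mono) auto
      also have "\<dots> = real n * (entropy_rate + 2 * \<tau>)" using k(1) by simp
      finally show ?thesis by (simp add: s_def algebra_simps)
    qed
    moreover have "C \<le> real n * \<tau>"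
      using elim(1) n by (simp add: pos_divide_less_eq mult.commute)
    ultimately have "ln (S_hat T n \<phi> M \<epsilon>) \<le>
        real n * (entropy_rate + 2 * \<tau>) + real n * \<tau> + real n * d"
      using main unfolding C_def by linarith
    also have "\<dots> = real n * ((\<integral>x. \<phi> x \<partial>M) + entropy_rate + \<theta>)"
      by (simp add: d_def \<tau>_def algebra_simps)
    finally show ?case .
  qed
qed

end

section \<open>The limit formula\<close>

context invariant_system
begin

text \<open>The passage back from a labelling to a partition, through which a labelling built by
  hand enters the supremum \<open>KS_entropy\<close>.\<close>

lemma simple_function_partition:
  assumes g: "simple_function M g"
  shows "finite_measurable_partition M ((\<lambda>v. g -` {v}) ` range g)"
    and "cell_of ((\<lambda>v. g -` {v}) ` range g) x = g -` {g x}"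
proof -
  let ?P = "(\<lambda>v. g -` {v}) ` range g"
  have part: "partition_on UNIV ?P"
  proof (rule partition_onI)
    show "\<Union>?P = UNIV" by auto
    show "disjnt A B" if "A \<in> ?P" "B \<in> ?P" "A \<noteq> B" for A B
      using that by (auto simp: disjnt_def)
  qed auto
  then show "finite_measurable_partition M ?P"
    using simple_range_finite[OF g] simple_vimage_sets[OF g]
    by (auto simp: finite_measurable_partition_def)
  show "cell_of ?P x = g -` {g x}"
    by (rule cell_of_eq[OF part]) simp_all
qed

end

theorem theorem5p3:
  fixes T :: "'a::metric_space \<Rightarrow> 'a" and \<mu> :: "'a measure" and \<phi> :: "'a \<Rightarrow> real"
  assumes "topological_dynamical_system T"
    and "\<mu> \<in> ergodic_measures T"
    and "continuous_on UNIV \<phi>"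
  shows "((\<lambda>\<epsilon>. liminf (\<lambda>n. ereal (1 / real n * ln (S_hat T n \<phi> \<mu> \<epsilon>))))
            \<longlongrightarrow> ereal (\<integral>x. \<phi> x \<partial>\<mu>) + KS_entropy \<mu> T) (at_right 0) \<and>
         ((\<lambda>\<epsilon>. limsup (\<lambda>n. ereal (1 / real n * ln (S_hat T n \<phi> \<mu> \<epsilon>))))
            \<longlongrightarrow> ereal (\<integral>x. \<phi> x \<partial>\<mu>) + KS_entropy \<mu> T) (at_right 0)"
proof -
  let ?a = "\<lambda>\<epsilon> n. ereal (1 / real n * ln (S_hat T n \<phi> \<mu> \<epsilon>))"
  let ?I = "\<integral>x. \<phi> x \<partial>\<mu>"
  let ?L = "ereal ?I + KS_entropy \<mu> T"
  have cpt: "compact (UNIV :: 'a set)" and cont: "continuous_on UNIV T"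
    using assms(1) by (auto simp: topological_dynamical_system_def homeomorphism_def)
  have \<mu>: "prob_space \<mu>" "sets \<mu> = sets borel" "distr \<mu> \<mu> T = \<mu>"
    and ergodic: "\<And>A. A \<in> sets \<mu> \<Longrightarrow> T -` A = A \<Longrightarrow> measure \<mu> A = 0 \<or> measure \<mu> A = 1"
    using assms(2) by (simp_all add: ergodic_measures_def)
  interpret prob_space \<mu> by (rule \<mu>(1))
  interpret invariant_system \<mu> T
  proof unfold_locales
    show "(1::real) < exp 1" by simp
    show "space \<mu> = UNIV" using sets_eq_imp_space_eq[OF \<mu>(2)] by simp
    show "T \<in> \<mu> \<rightarrow>\<^sub>M \<mu>"
      using borel_measurable_continuous_onI[OF cont] measurable_cong_sets[OF \<mu>(2) \<mu>(2)] by simp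
    show "distr \<mu> \<mu> T = \<mu>" by (rule \<mu>(3))
  qed
  have system: "borel_system \<mu> T (cell_of P)" if "finite_measurable_partition \<mu> P" for P
  proof -
    interpret labelled_system \<mu> T "cell_of P" by (rule labelled_system_cell_of[OF that])
    show ?thesis by unfold_locales (fact cpt cont \<mu>(2))+
  qed
  have lower: "\<forall>\<^sub>F \<epsilon> in at_right 0. b < liminf (?a \<epsilon>)" if b: "b < ?L" for b
  proof -
    \<comment> \<open>A real number is interposed because \<open>KS_entropy\<close> may be infinite;
      a single partition and finite quantities then suffice.\<close>
    obtain c where c: "b < ereal c" "ereal c < ?L" using ereal_dense2[OF b] by blast
    have "ereal (c - ?I) < KS_entropy \<mu> T"
    proof (rule ccontr)
      assume "\<not> ereal (c - ?I) < KS_entropy \<mu> T"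
      then have "?L \<le> ereal ?I + ereal (c - ?I)" by (intro add_left_mono) simp
      then show False using c(2) by simp
    qed
    then obtain P where P: "finite_measurable_partition \<mu> P" "c - ?I < entropy_wrt_partition \<mu> T P"
      by (auto simp: KS_entropy_def less_SUP_iff)
    interpret P: borel_system \<mu> T "cell_of P" by (rule system[OF P(1)])
    \<comment> \<open>Half of the gap: one \<theta> is lost in the lower bound, the other absorbs ln
      2 / n.\<close>
    define \<theta> where "\<theta> = (?I + P.entropy_rate - c) / 2"
    have "\<theta> > 0" using P(2) by (simp add: \<theta>_def entropy_wrt_partition_eq[OF P(1)])
    obtain \<epsilon>0 where \<epsilon>0: "\<epsilon>0 > 0" "\<And>\<epsilon> n. 0 < \<epsilon> \<Longrightarrow> \<epsilon> < \<epsilon>0 \<Longrightarrow> n \<ge> 1 \<Longrightarrow>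
        real n * (?I + P.entropy_rate - \<theta>) - ln 2 \<le> ln (S_hat T n \<phi> \<mu> \<epsilon>)"
      by (rule P.ln_S_hat_lower[OF assms(3) \<open>\<theta> > 0\<close>]) (rule that)
    have "b < liminf (?a \<epsilon>)" if \<epsilon>: "0 < \<epsilon>" "\<epsilon> < \<epsilon>0" for \<epsilon>
    proof -
      have "(\<lambda>n. ln 2 / real n) \<longlonglongrightarrow> 0" by (rule lim_const_over_n)
      then have "\<forall>\<^sub>F n in sequentially. ln 2 / real n < \<theta>"
        using \<open>\<theta> > 0\<close> by (intro order_tendstoD(2))
      then have "\<forall>\<^sub>F n in sequentially. ereal c \<le> ?a \<epsilon> n"
        using eventually_ge_at_top[of 1]
      proof eventually_elim
        case (elim n)
        have "ln 2 \<le> real n * \<theta>" using elim by (simp add: pos_divide_less_eq mult.commute)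
        moreover have "?I + P.entropy_rate = c + 2 * \<theta>" by (simp add: \<theta>_def field_simps)
        then have "real n * (c + \<theta>) - ln 2 \<le> ln (S_hat T n \<phi> \<mu> \<epsilon>)"
          using \<epsilon>0(2)[OF \<epsilon> elim(2)] by (simp add: add.commute)
        ultimately have "c * real n \<le> ln (S_hat T n \<phi> \<mu> \<epsilon>)" by (simp add: algebra_simps)
        then show ?case using elim(2) by (simp add: pos_le_divide_eq)
      qed
      then have "ereal c \<le> liminf (?a \<epsilon>)" by (rule Liminf_bounded)
      with c(1) show ?thesis by (rule less_le_trans)
    qed
    then show ?thesis
      using \<epsilon>0(1) by (auto simp: eventually_at_right_field)
  qed
  \<comment> \<open>This holds for each fixed \<epsilon> < 1 and not just in the limit, since the
    entropy of every partition is at most the supremum.\<close>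
  have upper: "limsup (?a \<epsilon>) \<le> ?L" if \<epsilon>: "0 < \<epsilon>" "\<epsilon> < 1" for \<epsilon>
  proof -
    obtain C :: "'a set" where C: "finite C" "UNIV \<subseteq> (\<Union>c\<in>C. ball c (\<epsilon> / 2))"
    proof (rule compactE_image[OF cpt, of UNIV "\<lambda>c. ball c (\<epsilon> / 2)"])
      show "UNIV \<subseteq> (\<Union>c\<in>(UNIV :: 'a set). ball c (\<epsilon> / 2))"
      proof
        fix x :: 'a
        show "x \<in> (\<Union>c\<in>UNIV. ball c (\<epsilon> / 2))" using \<epsilon>(1) by (intro UN_I[of x]) simp_all
      qed
    next
      fix D :: "'a set" assume "finite D" "UNIV \<subseteq> (\<Union>c\<in>D. ball c (\<epsilon> / 2))"
      then show thesis by (rule that)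
    qed simp
    \<comment> \<open>A point is labelled by the set of all centres near it. This set is never
      empty, so equal labels give a common centre and a distance below \<epsilon>.\<close>
    define g where "g = (\<lambda>x. {c \<in> C. dist c x < \<epsilon> / 2})"
    have g_near: "dist x y < \<epsilon>" if "g x = g y" for x y
    proof -
      have "x \<in> (\<Union>c\<in>C. ball c (\<epsilon> / 2))" by (rule subsetD[OF C(2) UNIV_I])
      then obtain c where "c \<in> C" "x \<in> ball c (\<epsilon> / 2)" by (rule UN_E)
      then have "c \<in> C" "dist c x < \<epsilon> / 2" by simp_all
      then have "c \<in> g x" by (simp add: g_def)
      then have "dist c y < \<epsilon> / 2" unfolding that by (simp add: g_def)
      then show ?thesis using dist_triangle3[of x y c] \<open>dist c x < \<epsilon> / 2\<close> by simp
    qed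
    have g_simple: "simple_function \<mu> g"
    proof -
      have "g -` {g x} \<in> sets \<mu>" for x
      proof -
        have "{y \<in> space \<mu>. dist c y < \<epsilon> / 2 \<longleftrightarrow> b} \<in> sets \<mu>" for c b
        proof -
          have "{y. dist c y < \<epsilon> / 2} = ball c (\<epsilon> / 2)" by auto
          then have "{y. dist c y < \<epsilon> / 2} \<in> sets \<mu>" by (simp add: \<mu>(2))
          with sets.compl_sets[OF this] show ?thesis
            by (cases b) (simp_all add: Collect_neg_eq Compl_eq_Diff_UNIV)
        qed
        then have "{y \<in> space \<mu>. \<forall>c\<in>C. dist c y < \<epsilon> / 2 \<longleftrightarrow> dist c x < \<epsilon> / 2} \<in> sets \<mu>"
          using C(1) by (intro sets.sets_Collect_finite_All)
        moreover have "{y \<in> space \<mu>. \<forall>c\<in>C. dist c y < \<epsilon> / 2 \<longleftrightarrow> dist c x < \<epsilon> / 2} = g -` {g x}"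
          unfolding g_def by (auto simp: set_eq_iff)
        ultimately show ?thesis by simp
      qed
      moreover have "finite (range g)"
        using C(1) by (intro finite_subset[of "range g" "Pow C"]) (auto simp: g_def)
      ultimately show ?thesis by (auto simp: simple_function_def)
    qed
    define P where "P = (\<lambda>v. g -` {v}) ` range g"
    have P: "finite_measurable_partition \<mu> P"
      unfolding P_def by (rule simple_function_partition(1)[OF g_simple])
    have diam: "dist x y < \<epsilon>" if "cell_of P x = cell_of P y" for x y
    proof (rule g_near)
      have "g -` {g x} = g -` {g y}"
        using that unfolding P_def simple_function_partition(2)[OF g_simple] .
      moreover have "x \<in> g -` {g x}" by simp
      ultimately have "x \<in> g -` {g y}" by (simp only:)
      then show "g x = g y" by simp
    qed
    interpret P: borel_system \<mu> T "cell_of P" by (rule system[OF P])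
    have "limsup (?a \<epsilon>) \<le> ereal (?I + P.entropy_rate)"
    proof (rule ereal_le_epsilon2)
      fix \<theta> :: real assume "\<theta> > 0"
      have "\<forall>\<^sub>F n in sequentially. ln (S_hat T n \<phi> \<mu> \<epsilon>) \<le> real n * (?I + P.entropy_rate + \<theta>)"
        by (rule P.ln_S_hat_upper[OF ergodic assms(3) diam \<epsilon> \<open>\<theta> > 0\<close>])
      then have "\<forall>\<^sub>F n in sequentially. ?a \<epsilon> n \<le> ereal (?I + P.entropy_rate + \<theta>)"
        using eventually_ge_at_top[of 1]
      proof eventually_elim
        case (elim n)
        then show ?case by (simp add: pos_divide_le_eq mult.commute)
      qed
      then show "limsup (?a \<epsilon>) \<le> ereal (?I + P.entropy_rate) + ereal \<theta>"
        by (simp add: Limsup_bounded)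
    qed
    also have "\<dots> \<le> ?L"
    proof -
      have "ereal P.entropy_rate \<le> KS_entropy \<mu> T"
        unfolding KS_entropy_def entropy_wrt_partition_eq[OF P, symmetric]
        using P by (intro SUP_upper) simp
      then show ?thesis by (simp only: plus_ereal.simps(1)[symmetric] add_left_mono)
    qed
    finally show ?thesis .
  qed
  have small: "\<forall>\<^sub>F \<epsilon> in at_right (0::real). limsup (?a \<epsilon>) \<le> ?L"
    using upper by (auto simp: eventually_at_right_field intro!: exI[of _ 1])
  have le: "liminf (?a \<epsilon>) \<le> limsup (?a \<epsilon>)" for \<epsilon> by (intro Liminf_le_Limsup) simp
  have "((\<lambda>\<epsilon>. liminf (?a \<epsilon>)) \<longlongrightarrow> ?L) (at_right 0)"
  proof (rule order_tendstoI)
    show "\<forall>\<^sub>F \<epsilon> in at_right 0. liminf (?a \<epsilon>) < b" if "?L < b" for b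
      using small by eventually_elim (rule le_less_trans[OF order_trans[OF le] that])
  qed (rule lower)
  moreover have "((\<lambda>\<epsilon>. limsup (?a \<epsilon>)) \<longlongrightarrow> ?L) (at_right 0)"
  proof (rule order_tendstoI)
    show "\<forall>\<^sub>F \<epsilon> in at_right 0. b < limsup (?a \<epsilon>)" if "b < ?L" for b
      using lower[OF that] by eventually_elim (rule less_le_trans[OF _ le])
    show "\<forall>\<^sub>F \<epsilon> in at_right 0. limsup (?a \<epsilon>) < b" if "?L < b" for b
      using small by eventually_elim (rule le_less_trans[OF _ that])
  qed
  ultimately show ?thesis by (rule conjI)
qed

end
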